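(* Let $S=\mathbb{C}[x_0,x_1,x_2]$ with its standard grading. There exists a form $f\in S_{13}$ of Waring rank $30$ and two finite sets of points $Z_1,Z_2\subset\mathbb{P}S_1\cong\mathbb{P}^2$, both computing the rank of $f$, such that $Z_1$ and $Z_2$ have different Hilbert functions and different regularities.
   Context: $S=\bigoplus_{d} S_d=\mathbb{C}[x_0,x_1,x_2]$ is the standard graded polynomial ring over $\mathbb{C}$ (ternary forms). For a homogeneous polynomial $f\in S_d$, the Waring rank $\mathrm{rk}(f)$ is the minimal $r$ such that $f=\sum_{i=1}^r \ell_i^d$ with $\ell_i\in S_1$. Let $\nu_d:\mathbb{P}S_1\to\mathbb{P}S_d$, $[\ell]\mapsto[\ell^d]$, be the Veronese embedding. A finite set of (distinct) points $A\subset\mathbb{P}S_1$ is apolar to $f\in S_d$ if $[f]\in\langle\nu_d(A)\rangle$ (the projective linear span of $\nu_d(A)$), i.e. $f$ is a linear combination of the $d$-th powers of linear forms representing the points of $A$. The set $A$ computes the rank of $f$ if it is apolar to $f$ and its cardinality equals $\mathrm{rk}(f)$. Let $R=\mathbb{C}[y_0,y_1,y_2]$ be the homogeneous coordinate ring of $\mathbb{P}S_1$, where the point $[a_0x_0+a_1x_1+a_2x_2]$ has homogeneous coordinates $(a_0:a_1:a_2)$. For a finite set $A\subset\mathbb{P}S_1$ with homogeneous vanishing ideal $I(A)\subset R$, the Hilbert function of $A$ is $h_A:\mathbb{Z}\to\mathbb{Z}$, $h_A(i)=\dim_{\mathbb{C}}R_i-\dim_{\mathbb{C}}I(A)_i$.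 For a non-empty finite set $A$, $h_A$ is strictly increasing on non-negative integers until it reaches the cardinality of $A$, after which it is constant; the regularity of $A$ is the smallest integer $i\ge 0$ such that $h_A(i)=h_A(i+1)$. *)

theory Defs
  imports Complex_Main "HOL-Library.Poly_Mapping" "HOL-Library.Numeral_Type"
begin

text \<open>
  Polynomials over the complex numbers in three variables, indexed by the type \<^typ>\<open>3\<close>, as finitely
  supported coefficient functions on exponent vectors. The same type serves both for
  \<open>S = \<complex>[x\<^sub>0, x\<^sub>1, x\<^sub>2]\<close> and for the homogeneous coordinate ring
  \<open>R = \<complex>[y\<^sub>0, y\<^sub>1, y\<^sub>2]\<close> of \<open>\<P>S\<^sub>1\<close>.
\<close>

type_synonym monom3 = "3 \<Rightarrow>\<^sub>0 nat"
type_synonym poly3 = "monom3 \<Rightarrow>\<^sub>0 complex"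

definition mdegree :: "monom3 \<Rightarrow> nat" where
  "mdegree m = (\<Sum>i\<in>UNIV. Poly_Mapping.lookup m i)"

text \<open>Degrees are integers, because Hilbert functions are defined on all of \<open>\<int>\<close>; the pieces of
  negative degree are zero.\<close>

definition graded_piece :: "int \<Rightarrow> poly3 set" where
  "graded_piece d = {p. \<forall>m\<in>Poly_Mapping.keys p. int (mdegree m) = d}"

definition cscale :: "complex \<Rightarrow> poly3 \<Rightarrow> poly3" where
  "cscale c p = Poly_Mapping.single 0 c * p"

global_interpretation cvs: vector_space cscale
  by unfold_locales
    (simp_all add: cscale_def distrib_left distrib_right single_add mult_single flip: mult.assoc)

definition waring_rank :: "nat \<Rightarrow> poly3 \<Rightarrow> nat" where
  "waring_rank d f =
    (LEAST r. \<exists>l :: nat \<Rightarrow> poly3. (\<forall>i<r. l i \<in> graded_piece 1) \<and> f = (\<Sum>i<r. l i ^ d))"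

text \<open>A point of a projective space is a one-dimensional linear subspace, as a set of vectors
  (including \<open>0\<close>).\<close>

definition proj_point :: "poly3 \<Rightarrow> poly3 set" where
  "proj_point v = cvs.span {v}"

definition proj :: "poly3 set \<Rightarrow> poly3 set set" where
  "proj V = proj_point ` (V - {0})"

definition proj_span :: "poly3 set set \<Rightarrow> poly3 set set" where
  "proj_span B = proj (cvs.span (\<Union>B))"

text \<open>The Veronese map \<open>[l] \<mapsto> [l\<^sup>d]\<close>, written without a choice of representative; see the lemma
  below.\<close>

definition veronese :: "nat \<Rightarrow> poly3 set \<Rightarrow> poly3 set" where
  "veronese d P = cvs.span ((\<lambda>l. l ^ d) ` P)"

lemma veronese_proj_point: "veronese d (proj_point l) = proj_point (l ^ d)"
proof -
  have pow: "cscale c l ^ d = cscale (c ^ d) (l ^ d)" for c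
  proof -
    have "Poly_Mapping.single 0 c ^ d = (Poly_Mapping.single 0 (c ^ d) :: poly3)"
      by (induction d) (simp_all add: mult_single)
    then show ?thesis
      by (simp add: cscale_def power_mult_distrib)
  qed
  have "cvs.span ((\<lambda>l. l ^ d) ` cvs.span {l}) \<subseteq> cvs.span {l ^ d}"
    by (rule cvs.span_minimal[OF _ cvs.subspace_span]) (auto simp: cvs.span_singleton pow)
  moreover have "cvs.span {l ^ d} \<subseteq> cvs.span ((\<lambda>l. l ^ d) ` cvs.span {l})"
    by (intro cvs.span_mono) (auto intro: cvs.span_base)
  ultimately show ?thesis
    by (simp add: veronese_def proj_point_def)
qed

definition apolar :: "nat \<Rightarrow> poly3 set set \<Rightarrow> poly3 \<Rightarrow> bool" where
  "apolar d A f \<longleftrightarrow> proj_point f \<in> proj_span (veronese d ` A)"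

definition computes_rank :: "nat \<Rightarrow> poly3 set set \<Rightarrow> poly3 \<Rightarrow> bool" where
  "computes_rank d A f \<longleftrightarrow>
    finite A \<and> A \<subseteq> proj (graded_piece 1) \<and> apolar d A f \<and> card A = waring_rank d f"

text \<open>The linear form \<open>a\<^sub>0 x\<^sub>0 + a\<^sub>1 x\<^sub>1 + a\<^sub>2 x\<^sub>2\<close> has coordinates \<open>(a\<^sub>0, a\<^sub>1, a\<^sub>2)\<close>.\<close>

definition coords :: "poly3 \<Rightarrow> 3 \<Rightarrow> complex" where
  "coords l i = Poly_Mapping.lookup l (Poly_Mapping.single i 1)"

definition eval3 :: "poly3 \<Rightarrow> (3 \<Rightarrow> complex) \<Rightarrow> complex" where
  "eval3 g a = (\<Sum>m\<in>Poly_Mapping.keys g.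
    Poly_Mapping.lookup g m * (\<Prod>i\<in>UNIV. a i ^ Poly_Mapping.lookup m i))"

text \<open>Vanishing is required at all nonzero representatives of each point. Over the infinite field
  \<open>\<complex>\<close> the polynomials with this property form a homogeneous ideal, the one generated by the forms
  vanishing on \<open>A\<close>.\<close>

definition vanishing_ideal :: "poly3 set set \<Rightarrow> poly3 set" where
  "vanishing_ideal A = {g. \<forall>P\<in>A. \<forall>l\<in>P - {0}. eval3 g (coords l) = 0}"

definition hilbert_function :: "poly3 set set \<Rightarrow> int \<Rightarrow> int" where
  "hilbert_function A i =
    int (cvs.dim (graded_piece i)) - int (cvs.dim (vanishing_ideal A \<inter> graded_piece i))"

definition regularity :: "poly3 set set \<Rightarrow> nat" where
  "regularity A = (LEAST i. hilbert_function A (int i) = hilbert_function A (int i + 1))"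

end

theory Submission
  imports Defs "HOL-Computational_Algebra.Polynomial"
begin

text \<open>
The form is \<open>f = 286 (x\<^sup>1\<^sup>0 y\<^sup>3 + x\<^sup>1\<^sup>0 z\<^sup>3 + y\<^sup>1\<^sup>0 z\<^sup>3) + y\<^sup>1\<^sup>3\<close>. A sum of powers
\<open>(a\<^sub>s x + b\<^sub>s y + c\<^sub>s z)\<^sup>1\<^sup>3\<close> equals \<open>f\<close> exactly when the sums of the numbers
\<open>a\<^sub>s\<^sup>i b\<^sub>s\<^sup>j c\<^sub>s\<^sup>k\<close> with \<open>i + j + k = 13\<close> are the coefficients of \<open>f\<close> divided by the multinomial
coefficients, which is \<open>1\<close> for the four monomials of \<open>f\<close> and \<open>0\<close> otherwise (\<open>moment\<close>). So a
decomposition of \<open>f\<close> is a way to write one fixed functional on forms of degree 13 in \<open>X, Y, Z\<close> as a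
combination of evaluations at points.

Why thirty powers are necessary (\<open>moment_rank_bound\<close>). Let \<open>A\<^sub>1\<close> be the points off the line
\<open>Z = 0\<close> and let \<open>\<delta>\<close> be the number of points on this line other than the two vertices \<open>x\<close> and \<open>y\<close>.
There are at least \<open>30 - \<delta>\<close> test monomials such that no nonzero form supported on them can vanish on
\<open>A\<^sub>1\<close>: divide such a form by the power of \<open>Z\<close> in it and look at what remains on \<open>Z = 0\<close>.
Multiplication by \<open>Z\<close> makes the sum over all points vanish, and multiplication by \<open>X Y\<close> and by a form
of degree \<open>\<delta>\<close> through the points on the line does so too. Comparison with the moments kills the
remaining coefficients one by one. Hence \<open>A\<^sub>1\<close> has at least \<open>30 - \<delta>\<close> points.

Why thirty suffice, in more than one way. The form splits into binary forms on the three sides of the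
triangle \<open>XYZ = 0\<close>, and each of them is a combination of ten powers. The pieces are not unique:
neighbouring sides may exchange multiples of \<open>y\<^sup>1\<^sup>3\<close> and \<open>z\<^sup>1\<^sup>3\<close> at the common vertex. This freedom
gives the sets \<open>section_points\<close> and \<open>nonsection_points\<close>.

Why the Hilbert functions differ. Ten points on each side impose independent conditions on forms of
degree 11 or more. In degree 10 the sets part: the first one is cut out on the triangle by
\<open>X\<^sup>1\<^sup>0 - Y\<^sup>1\<^sup>0 + Z\<^sup>1\<^sup>0\<close>, so it is a complete intersection of type \<open>(3, 10)\<close> and its residues give a relation
between the values of forms of degree 10 (\<open>section_points_relation\<close>), whereas the second one admits
no such relation (\<open>nonsection_points_no_relation\<close>). Since a Hilbert function that repeats a value
is constant from there on (\<open>hilbert_function_stable\<close>), the regularity exceeds 10 for the first set and is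
at most 10 for the second. The regularity depends only on the Hilbert function, so the latter differs too.
\<close>

section \<open>Linear systems, Vandermonde and roots of a constant\<close>

text \<open>
Gaussian elimination: an equation with a nonzero coefficient lets one eliminate one unknown, and an
equation without one can be dropped.
\<close>

lemma underdetermined_system:
  fixes a :: "'i \<Rightarrow> 's \<Rightarrow> 'a::field"
  assumes "finite I" "finite S" "card I < card S"
  shows "\<exists>s. (\<exists>m\<in>S. s m \<noteq> 0) \<and> (\<forall>i\<in>I. (\<Sum>m\<in>S. s m * a i m) = 0)"
  using assms
proof (induction I arbitrary: S a rule: finite_induct)
  case empty
  then have "S \<noteq> {}" by auto
  then show ?case by (intro exI[of _ "\<lambda>_. 1"]) auto
next
  case (insert i I)
  show ?case
  proof (cases "\<forall>m\<in>S. a i m = 0")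
    case True
    have "card I < card S" using insert by simp
    from insert.IH[OF insert.prems(1) this, of a] True show ?thesis by auto
  next
    case False
    then obtain m0 where m0: "m0 \<in> S" "a i m0 \<noteq> 0" by blast
    define S' where "S' = S - {m0}"
    have fin: "finite S'" and c: "card I < card S'"
      using insert m0 by (auto simp: S'_def)
    from insert.IH[OF fin c, of "\<lambda>j m. a j m - a j m0 * a i m / a i m0"]
    obtain s where s: "\<exists>m\<in>S'. s m \<noteq> 0"
      "\<And>j. j \<in> I \<Longrightarrow> (\<Sum>m\<in>S'. s m * (a j m - a j m0 * a i m / a i m0)) = 0" by blast
    define c0 where "c0 = (\<Sum>m\<in>S'. s m * a i m) / a i m0"
    define s' where "s' = s(m0 := - c0)"
    have S: "S = insert m0 S'" "m0 \<notin> S'" using m0 by (auto simp: S'_def)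
    have sum: "(\<Sum>m\<in>S. s' m * a j m) = (\<Sum>m\<in>S'. s m * a j m) - c0 * a j m0" for j
    proof -
      have "(\<Sum>m\<in>S'. s' m * a j m) = (\<Sum>m\<in>S'. s m * a j m)"
        using S by (intro sum.cong) (auto simp: s'_def)
      then show ?thesis using S fin by (simp add: s'_def)
    qed
    have "(\<Sum>m\<in>S. s' m * a j m) = 0" if "j \<in> insert i I" for j
    proof (cases "j = i")
      case True
      then show ?thesis using m0 by (simp add: sum c0_def)
    next
      case False
      have "(\<Sum>m\<in>S'. s m * (a j m - a j m0 * a i m / a i m0))
        = (\<Sum>m\<in>S'. s m * a j m) - c0 * a j m0"
        by (simp add: c0_def right_diff_distrib sum_subtractf sum_distrib_left sum_distrib_right
            sum_divide_distrib mult_ac)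
      then show ?thesis using s(2)[of j] False that by (simp add: sum)
    qed
    moreover have "\<exists>m\<in>S. s' m \<noteq> 0"
      using s(1) S by (auto simp: s'_def)
    ultimately show ?thesis by blast
  qed
qed

text \<open>
Nonsingularity of the Vandermonde matrix: the weights are tested against the polynomial of degree
\<open>card T - 1\<close> whose roots are all points of \<open>T\<close> but one.
\<close>

lemma vanishing_moments_imp_zero:
  fixes d :: "'a::field \<Rightarrow> 'a"
  assumes "finite T" and "\<And>j. j < card T \<Longrightarrow> (\<Sum>t\<in>T. d t * t ^ j) = 0" and "t \<in> T"
  shows "d t = 0"
proof -
  define p where "p = (\<Prod>u\<in>T - {t}. [:- u, 1:])"
  have "degree p = card (T - {t})"
    unfolding p_def by (subst degree_prod_eq_sum_degree) auto
  then have deg: "degree p < card T"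
    using assms by (metis card_Diff1_less)
  have "(\<Sum>u\<in>T. d u * poly p u) = (\<Sum>j\<le>degree p. coeff p j * (\<Sum>u\<in>T. d u * u ^ j))"
    unfolding poly_altdef sum_distrib_left
    by (subst sum.swap) (simp add: mult_ac)
  also have "\<dots> = 0" using assms(2) deg by (intro sum.neutral) auto
  finally have 0: "(\<Sum>u\<in>T. d u * poly p u) = 0" .
  have pz: "poly p u = 0" if "u \<in> T - {t}" for u
    unfolding p_def poly_prod by (rule prod_zero) (use assms(1) that in auto)
  have "(\<Sum>u\<in>T. d u * poly p u) = d t * poly p t + (\<Sum>u\<in>T - {t}. d u * poly p u)"
    using assms by (simp add: sum.remove)
  also have "(\<Sum>u\<in>T - {t}. d u * poly p u) = 0"
    by (rule sum.neutral) (use pz in auto)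
  finally have "d t * poly p t = 0" using 0 by simp
  moreover have "poly p t \<noteq> 0"
    using assms(1) by (auto simp: p_def poly_prod)
  ultimately show ?thesis by simp
qed

text \<open>
Multiplication by a primitive root of unity permutes the roots and multiplies the sum by a factor,
which differs from \<open>1\<close> unless \<open>n\<close> divides the exponent.
\<close>

lemma sum_powers_nth_roots:
  fixes r :: complex
  assumes "n > 0" "r \<noteq> 0"
  shows "(\<Sum>t | t ^ n = r. t ^ k) = (if n dvd k then of_nat n * r ^ (k div n) else 0)"
proof (cases "n dvd k")
  case True
  then obtain q where k: "k = n * q" by blast
  have "(\<Sum>t | t ^ n = r. t ^ k) = (\<Sum>t | t ^ n = r. r ^ q)"
    by (rule sum.cong) (auto simp: k power_mult)
  then show ?thesis using assms card_nth_roots[of r n] by (simp add: k)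
next
  case False
  define w where "w = cis (2 * pi / n)"
  have wn: "w ^ n = 1" using assms by (simp add: w_def DeMoivre)
  have wk: "w ^ k \<noteq> 1"
  proof
    assume "w ^ k = 1"
    have k: "w ^ k = w ^ (k mod n)"
      by (metis wn power_mult power_add mult_div_mod_eq power_one mult_1)
    have bij: "inj_on (\<lambda>k. cis (2 * pi * real k / real n)) {..<n}"
      using bij_betw_roots_unity[of n] assms by (auto simp: bij_betw_def)
    have "w ^ (k mod n) = cis (2 * pi * real (k mod n) / real n)"
      by (simp add: w_def DeMoivre mult_ac)
    moreover have "cis (2 * pi * real 0 / real n) = 1" by simp
    ultimately have "k mod n = 0"
      using inj_onD[OF bij, of "k mod n" 0] \<open>w ^ k = 1\<close> k assms by simp
    then show False using False by auto
  qed
  have "w \<noteq> 0" by (simp add: w_def)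
  have "(\<Sum>t | t ^ n = r. t ^ k) = (\<Sum>t | t ^ n = r. (w * t) ^ k)"
    by (rule sum.reindex_bij_witness[of _ "\<lambda>t. w * t" "\<lambda>t. t / w"])
      (use wn \<open>w \<noteq> 0\<close> in \<open>auto simp: power_mult_distrib power_divide\<close>)
  also have "\<dots> = w ^ k * (\<Sum>t | t ^ n = r. t ^ k)"
    by (simp add: power_mult_distrib sum_distrib_left)
  finally show ?thesis using wk False by auto
qed

text \<open>
The sequences of moments that can be supported on the roots of \<open>t\<^sup>n = r\<close> are the solutions of the
recurrence \<open>m (b + n) = r * m b\<close>, with arbitrary initial values \<open>A\<close>. The weights are found by discrete
Fourier inversion.
\<close>

lemma nth_roots_moments:
  fixes r :: complex
  assumes "n > 0" "r \<noteq> 0"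
  shows "\<exists>c. \<forall>b. (\<Sum>t | t ^ n = r. c t * t ^ b) = A (b mod n) * r ^ (b div n)"
proof -
  define c where "c t = (\<Sum>a<n. A a * t ^ (n - a)) / (of_nat n * r)" for t
  have "(\<Sum>t | t ^ n = r. c t * t ^ b) = A (b mod n) * r ^ (b div n)" for b
  proof -
    have "(\<Sum>t | t ^ n = r. c t * t ^ b) =
        (\<Sum>a<n. A a * (\<Sum>t | t ^ n = r. t ^ (n - a + b))) / (of_nat n * r)"
      unfolding c_def sum_divide_distrib sum_distrib_right sum_distrib_left
      by (subst sum.swap) (auto intro!: sum.cong simp: mult_ac add.commute simp flip: power_add)
    also have "(\<Sum>a<n. A a * (\<Sum>t | t ^ n = r. t ^ (n - a + b))) =
        (\<Sum>a<n. if a = b mod n then A a * (of_nat n * r ^ (b div n + 1)) else 0)"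
    proof (rule sum.cong)
      fix a assume a: "a \<in> {..<n}"
      have eq: "n - a + b = (n + b mod n - a) + n * (b div n)"
        using a by (simp add: algebra_simps)
      have dv: "n dvd n - a + b \<longleftrightarrow> n dvd n + b mod n - a"
        unfolding eq by (meson dvd_add_left_iff dvd_triv_left)
      show "A a * (\<Sum>t | t ^ n = r. t ^ (n - a + b)) =
          (if a = b mod n then A a * (of_nat n * r ^ (b div n + 1)) else 0)"
      proof (cases "a = b mod n")
        case True
        then have "n - a + b = n * (b div n + 1)" unfolding eq using assms by simp
        then show ?thesis using True assms
          by (subst sum_powers_nth_roots) simp_all
      next
        case False
        have "\<not> n dvd n + b mod n - a"
        proof
          assume "n dvd n + b mod n - a"
          then obtain q where q: "n + b mod n - a = n * q" by blast
          have "b mod n < n" using assms by simp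
          then have "0 < n * q" "n * q < n * 2"
            unfolding q[symmetric] using a[unfolded lessThan_iff] by linarith+
          then have "0 < q" "q < 2" by simp_all
          then have "q = 1" by simp
          then show False using q False a by simp
        qed
        then show ?thesis using False dv assms by (subst sum_powers_nth_roots) auto
      qed
    qed simp
    also have "\<dots> = A (b mod n) * (of_nat n * r ^ (b div n + 1))"
      using assms by (simp add: sum.delta)
    finally show ?thesis using assms by simp
  qed
  then show ?thesis by blast
qed

section \<open>The lower bound for the rank\<close>

text \<open>
The coefficients of the form that is studied, divided by the multinomial coefficients. The term for
\<open>y\<^sup>1\<^sup>3\<close> makes it possible to give all point sets below by roots of constants.
\<close>

definition moment :: "nat \<Rightarrow> nat \<Rightarrow> nat \<Rightarrow> complex" where
  "moment i j k = of_bool ((i, j, k) \<in> {(10, 3, 0), (10, 0, 3), (0, 10, 3), (0, 13, 0)})"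

text \<open>
A pair \<open>(a, b)\<close> stands for the monomial \<open>X\<^sup>a Y\<^sup>b Z\<^sup>1\<^sup>1\<^sup>-\<^sup>a\<^sup>-\<^sup>b\<close>. The first two families are a basis of a
complement of the ideal \<open>(XY, X\<^sup>1\<^sup>0 - Y\<^sup>1\<^sup>0)\<close> of \<open>\<complex>[X, Y]\<close>, of dimension 20. The \<open>10 - d\<close> monomials of the
third family are extra room gained when only \<open>d\<close> points lie on the line \<open>Z = 0\<close>.
\<close>

definition test_monomials :: "nat \<Rightarrow> (nat \<times> nat) set" where
  "test_monomials d = (\<lambda>a. (a, 0)) ` {..10} \<union> (\<lambda>b. (0, b)) ` {1..9} \<union>
    (if d \<le> 9 then insert (1, 1) ((\<lambda>m. (m, 2)) ` {1..9 - d}) else {})"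

lemma finite_test_monomials: "finite (test_monomials d)"
  by (simp add: test_monomials_def)

lemma test_monomials_cases:
  assumes "m \<in> test_monomials d"
  obtains a where "m = (a, 0)" "a \<le> 10"
  | b where "m = (0, b)" "1 \<le> b" "b \<le> 9"
  | "m = (1, 1)" "d \<le> 9"
  | a where "m = (a, 2)" "1 \<le> a" "a + d \<le> 9"
  using assms by (fastforce simp: test_monomials_def split: if_splits)

lemma card_test_monomials: "card (test_monomials d) + d \<ge> 30"
proof -
  let ?A = "(\<lambda>a. (a, 0)) ` {..10::nat} \<union> (\<lambda>b. (0, b)) ` {1..9::nat}"
  let ?B = "insert (1, 1) ((\<lambda>m. (m, 2)) ` {1..9 - d}) :: (nat \<times> nat) set"
  have A: "card ?A = 20"
    by (subst card_Un_disjoint) (auto simp: card_image inj_on_def)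
  have B: "card ?B = Suc (9 - d)"
    by (subst card_insert_disjoint) (auto simp: card_image inj_on_def)
  have "card (?A \<union> ?B) = card ?A + card ?B"
    by (rule card_Un_disjoint) auto
  then show ?thesis
    using A B by (auto simp: test_monomials_def)
qed

text \<open>
Suppose that there are at most 29 points. The test monomials then outnumber the points off the line
\<open>Z = 0\<close>, so some nonzero combination of them vanishes at these points. Its part of lowest degree in \<open>Z\<close>
is a combination of powers of \<open>X\<close> and \<open>Y\<close> and at most one more monomial, and each coefficient is read off
as the value of the functional on a suitable multiple, at which every point contributes zero.
\<close>

lemma moment_rank_bound:
  fixes x y z :: "'i \<Rightarrow> complex"
  assumes "finite I"
    and mom: "\<And>i j k. i + j + k = 13 \<Longrightarrow> (\<Sum>t\<in>I. x t ^ i * y t ^ j * z t ^ k) = moment i j k"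
  shows "card I \<ge> 30"
proof (rule ccontr)
  assume "\<not> ?thesis"
  define I1 where "I1 = {t \<in> I. z t \<noteq> 0}"
  define I0 where "I0 = {t \<in> I. z t = 0 \<and> x t \<noteq> 0 \<and> y t \<noteq> 0}"
  define d where "d = card I0"
  define S where "S = test_monomials d"
  have fin: "finite I1" "finite I0" "finite S"
    using assms by (auto simp: I1_def I0_def S_def finite_test_monomials)
  have "card I1 + card I0 \<le> card I"
    using fin assms by (subst card_Un_disjoint[symmetric]) (auto simp: I1_def I0_def intro!: card_mono)
  then have "card I1 < card S"
    using card_test_monomials[of d] \<open>\<not> card I \<ge> 30\<close> by (simp add: d_def S_def)
  from underdetermined_system[OF fin(1,3) this, of "\<lambda>t m. x t ^ fst m * y t ^ snd m * z t ^ (11 - fst m - snd m)"]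
  obtain s where s: "\<exists>m\<in>S. s m \<noteq> 0" and
    sv: "\<And>t. t \<in> I1 \<Longrightarrow> (\<Sum>m\<in>S. s m * (x t ^ fst m * y t ^ snd m * z t ^ (11 - fst m - snd m))) = 0"
    by blast
  \<comment> \<open>The largest degree in \<open>X\<close> and \<open>Y\<close>; after division by \<open>Z\<^sup>1\<^sup>1\<^sup>-\<^sup>i\<close> the form no longer vanishes on \<open>Z = 0\<close>.\<close>
  define i where "i = Max ((\<lambda>m. fst m + snd m) ` {m \<in> S. s m \<noteq> 0})"
  have i_ge: "fst m + snd m \<le> i" if "m \<in> S" "s m \<noteq> 0" for m
    unfolding i_def using that fin by (intro Max_ge) auto
  have "i \<in> (\<lambda>m. fst m + snd m) ` {m \<in> S. s m \<noteq> 0}"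
    unfolding i_def using s fin by (intro Max_in) auto
  then obtain m1 where m1: "m1 \<in> S" "s m1 \<noteq> 0" "fst m1 + snd m1 = i" by auto
  have S_le: "fst m + snd m \<le> 11" if "m \<in> S" for m
    using that unfolding S_def by (cases rule: test_monomials_cases) auto
  then have i11: "i \<le> 11" using m1 by auto
  define S' where "S' = {m \<in> S. fst m + snd m \<le> i}"
  have fin': "finite S'" using fin by (simp add: S'_def)
  define p where "p t = (\<Sum>m\<in>S'. s m * (x t ^ fst m * y t ^ snd m * z t ^ (i - fst m - snd m)))" for t
  have p1: "p t = 0" if "t \<in> I1" for t
  proof -
    have "(\<Sum>m\<in>S. s m * (x t ^ fst m * y t ^ snd m * z t ^ (11 - fst m - snd m))) =
        (\<Sum>m\<in>S'. s m * (x t ^ fst m * y t ^ snd m * z t ^ (11 - fst m - snd m)))"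
      using fin i_ge by (intro sum.mono_neutral_right) (auto simp: S'_def)
    also have "\<dots> = z t ^ (11 - i) * p t"
      unfolding p_def sum_distrib_left
    proof (rule sum.cong)
      fix m assume "m \<in> S'"
      then have "11 - fst m - snd m = (11 - i) + (i - fst m - snd m)"
        using i11 by (auto simp: S'_def)
      then show "s m * (x t ^ fst m * y t ^ snd m * z t ^ (11 - fst m - snd m)) =
          z t ^ (11 - i) * (s m * (x t ^ fst m * y t ^ snd m * z t ^ (i - fst m - snd m)))"
        by (simp only: power_add mult_ac)
    qed simp
    finally show ?thesis using sv[OF that] that by (auto simp: I1_def)
  qed
  \<comment> \<open>Both sides are the functional applied to the product of the form with a monomial.\<close>
  have pairing: "(\<Sum>t\<in>I. p t * (x t ^ u * y t ^ v * z t ^ w)) =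
      (\<Sum>m\<in>S'. s m * moment (fst m + u) (snd m + v) (i - fst m - snd m + w))"
    if "u + v + w + i = 13" for u v w
  proof -
    have "(\<Sum>t\<in>I. p t * (x t ^ u * y t ^ v * z t ^ w)) = (\<Sum>m\<in>S'. s m *
        (\<Sum>t\<in>I. x t ^ (fst m + u) * y t ^ (snd m + v) * z t ^ (i - fst m - snd m + w)))"
      unfolding p_def sum_distrib_right sum_distrib_left
      by (subst sum.swap) (simp only: power_add mult_ac)
    also have "\<dots> = (\<Sum>m\<in>S'. s m * moment (fst m + u) (snd m + v) (i - fst m - snd m + w))"
      using that by (intro sum.cong refl arg_cong2[where f = "(*)"] mom) (auto simp: S'_def)
    finally show ?thesis .
  qed
  have single_term: "(\<Sum>m\<in>S'. s m * g m) = s m0 * g m0"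
    if "m0 \<in> S'" "\<And>m. m \<in> S' \<Longrightarrow> m \<noteq> m0 \<Longrightarrow> s m * g m = 0" for m0 g
  proof -
    have "(\<Sum>m\<in>S' - {m0}. s m * g m) = 0"
      by (rule sum.neutral) (use that(2) in blast)
    then show ?thesis using sum.remove[OF fin' that(1), of "\<lambda>m. s m * g m"] by simp
  qed
  have S'_cases: thesis if "m \<in> S'"
    "\<And>a. m = (a, 0) \<Longrightarrow> a \<le> 10 \<Longrightarrow> a \<le> i \<Longrightarrow> thesis"
    "\<And>b. m = (0, b) \<Longrightarrow> 1 \<le> b \<Longrightarrow> b \<le> 9 \<Longrightarrow> b \<le> i \<Longrightarrow> thesis"
    "m = (1, 1) \<Longrightarrow> d \<le> 9 \<Longrightarrow> 2 \<le> i \<Longrightarrow> thesis"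
    "\<And>a. m = (a, 2) \<Longrightarrow> 1 \<le> a \<Longrightarrow> a + d \<le> 9 \<Longrightarrow> a + 2 \<le> i \<Longrightarrow> thesis" for m thesis
  proof -
    have "m \<in> test_monomials d" and le: "fst m + snd m \<le> i" using that(1) by (auto simp: S'_def S_def)
    from this(1) show thesis
      by (cases rule: test_monomials_cases) (use le that in auto)
  qed

  \<comment> \<open>A multiple by \<open>Z\<^sup>3\<close> vanishes at all points, on and off the line, and the moments with third exponent 3 see only one coefficient.\<close>
  have x_power: "s (i, 0) = 0" if "(i, 0) \<in> S"
  proof -
    have i: "i \<le> 10" using that unfolding S_def by (cases rule: test_monomials_cases) auto
    have "0 = (\<Sum>t\<in>I. p t * (x t ^ (10 - i) * y t ^ 0 * z t ^ 3))"
      using p1 by (intro sum.neutral[symmetric]) (auto simp: I1_def)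
    also have "\<dots> = (\<Sum>m\<in>S'. s m * moment (fst m + (10 - i)) (snd m + 0) (i - fst m - snd m + 3))"
      using i by (intro pairing) simp
    also have "\<dots> = s (i, 0) * moment (fst (i, 0::nat) + (10 - i)) (snd (i, 0::nat) + 0) (i - fst (i, 0::nat) - snd (i, 0::nat) + 3)"
    proof (rule single_term)
      show "(i, 0) \<in> S'" using that by (simp add: S'_def)
      fix m assume "m \<in> S'" "m \<noteq> (i, 0)"
      then show "s m * moment (fst m + (10 - i)) (snd m + 0) (i - fst m - snd m + 3) = 0"
        by (elim S'_cases) (use i in \<open>auto simp: moment_def\<close>)
    qed
    also have "\<dots> = s (i, 0)" using i by (simp add: moment_def)
    finally show ?thesis by simp
  qed
  have y_power: "s (0, i) = 0" if "(0, i) \<in> S"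
  proof (cases "i = 0")
    case True
    then show ?thesis using x_power that by simp
  next
    case False
    from that have i: "i \<le> 9" unfolding S_def by (cases rule: test_monomials_cases) (use False in auto)
    have "0 = (\<Sum>t\<in>I. p t * (x t ^ 0 * y t ^ (10 - i) * z t ^ 3))"
      using p1 by (intro sum.neutral[symmetric]) (auto simp: I1_def)
    also have "\<dots> = (\<Sum>m\<in>S'. s m * moment (fst m + 0) (snd m + (10 - i)) (i - fst m - snd m + 3))"
      using i by (intro pairing) simp
    also have "\<dots> = s (0, i) * moment (fst (0::nat, i) + 0) (snd (0::nat, i) + (10 - i)) (i - fst (0::nat, i) - snd (0::nat, i) + 3)"
    proof (rule single_term)
      show "(0, i) \<in> S'" using that by (simp add: S'_def)
      fix m assume "m \<in> S'" "m \<noteq> (0, i)"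
      then show "s m * moment (fst m + 0) (snd m + (10 - i)) (i - fst m - snd m + 3) = 0"
        by (elim S'_cases) (use i False in \<open>auto simp: moment_def\<close>)
    qed
    also have "\<dots> = s (0, i)" using i by (simp add: moment_def)
    finally show ?thesis by simp
  qed

  \<comment> \<open>The form \<open>al\<close> of degree \<open>d\<close> vanishes at the points of the line other than its vertices. As these have \<open>y \<noteq> 0\<close>, its coefficient at \<open>X\<^sup>d\<close> is nonzero.\<close>
  define q where "q = (\<Prod>t\<in>I0. [:- (y t / x t), 1:])"
  have q0: "coeff q 0 \<noteq> 0"
    using fin by (auto simp: q_def poly_0_coeff_0[symmetric] poly_prod I0_def)
  have degq: "degree q = d"
    unfolding q_def d_def by (subst degree_prod_eq_sum_degree) auto
  define al where "al t = (\<Sum>k\<le>d. coeff q k * (x t ^ (d - k) * y t ^ k))" for t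
  have al0: "al t = 0" if "t \<in> I0" for t
  proof -
    have "al t = x t ^ d * poly q (y t / x t)"
      unfolding al_def poly_altdef degq sum_distrib_left
      using that by (intro sum.cong) (auto simp: I0_def power_divide power_diff)
    also have "poly q (y t / x t) = 0"
      unfolding q_def poly_prod by (rule prod_zero) (use fin that in auto)
    finally show ?thesis by simp
  qed
  have pairing_al: "(\<Sum>t\<in>I. p t * al t * (x t ^ u * y t ^ v)) = (\<Sum>k\<le>d. coeff q k *
      (\<Sum>m\<in>S'. s m * moment (fst m + (d - k + u)) (snd m + (k + v)) (i - fst m - snd m)))"
    if "u + v + d + i = 13" for u v
  proof -
    have "(\<Sum>t\<in>I. p t * al t * (x t ^ u * y t ^ v)) = (\<Sum>k\<le>d. coeff q k *
        (\<Sum>t\<in>I. p t * (x t ^ (d - k + u) * y t ^ (k + v) * z t ^ 0)))"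
      unfolding al_def sum_distrib_right sum_distrib_left
      by (subst sum.swap) (simp only: power_add mult_ac power_0 mult_1 mult_1_right)
    also have "\<dots> = (\<Sum>k\<le>d. coeff q k *
      (\<Sum>m\<in>S'. s m * moment (fst m + (d - k + u)) (snd m + (k + v)) (i - fst m - snd m + 0)))"
      using that by (intro sum.cong refl arg_cong2[where f = "(*)"] pairing) auto
    finally show ?thesis by simp
  qed
  have first_term: "(\<Sum>k\<le>d. coeff q k * g k) = coeff q 0 * g 0"
    if "\<And>k. 0 < k \<Longrightarrow> k \<le> d \<Longrightarrow> g k = 0" for g :: "nat \<Rightarrow> complex"
    using that by (subst sum.remove[of _ 0]) (auto intro!: sum.neutral)

  \<comment> \<open>The form is \<open>s (1, 1) X Y\<close> on the line, so the vertices contribute nothing either.\<close>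
  have xy: "s (1, 1) = 0" if "(1, 1) \<in> S" "i = 2"
  proof -
    have d: "d \<le> 9" using that(1) unfolding S_def by (cases rule: test_monomials_cases) auto
    have mem: "(2, 0) \<in> S" "(0, 2) \<in> S" by (auto simp: S_def test_monomials_def)
    have s2: "s (2, 0) = 0" "s (0, 2) = 0"
      using x_power y_power mem that by auto
    have two: "m = (2, 0) \<or> m = (0, 2) \<or> m = (1, 1)" if "fst m + snd m = 2" for m :: "nat \<times> nat"
      using that by (cases m; cases "fst m") auto
    have p0: "p t = 0" if "z t = 0" "x t = 0 \<or> y t = 0" for t
      unfolding p_def
    proof (intro sum.neutral ballI)
      fix m assume m: "m \<in> S'"
      show "s m * (x t ^ fst m * y t ^ snd m * z t ^ (i - fst m - snd m)) = 0"
      proof (cases "fst m + snd m = 2")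
        case True
        then show ?thesis using two[OF True] s2 that by auto
      next
        case False
        then have "i - fst m - snd m > 0" using m \<open>i = 2\<close> by (auto simp: S'_def)
        then show ?thesis using that by simp
      qed
    qed
    have "0 = (\<Sum>t\<in>I. p t * al t * (x t ^ (9 - d) * y t ^ 2))"
    proof (intro sum.neutral[symmetric] ballI)
      fix t assume "t \<in> I"
      then show "p t * al t * (x t ^ (9 - d) * y t ^ 2) = 0"
        using p0[of t] p1[of t] al0[of t] by (auto simp: I1_def I0_def)
    qed
    also have "\<dots> = (\<Sum>k\<le>d. coeff q k *
      (\<Sum>m\<in>S'. s m * moment (fst m + (d - k + (9 - d))) (snd m + (k + 2)) (i - fst m - snd m)))"
      using d that by (intro pairing_al) simp
    also have "\<dots> = coeff q 0 * (\<Sum>m\<in>S'. s m * moment (fst m + (d - 0 + (9 - d))) (snd m + (0 + 2)) (i - fst m - snd m))"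
    proof (intro first_term sum.neutral ballI)
      fix k m assume k: "0 < k" "k \<le> d" and m: "m \<in> S'"
      show "s m * moment (fst m + (d - k + (9 - d))) (snd m + (k + 2)) (i - fst m - snd m) = 0"
      proof (cases "fst m + snd m = 2")
        case True
        then show ?thesis using two[OF True] s2 k d by (auto simp: moment_def)
      qed (use m \<open>i = 2\<close> in \<open>auto simp: S'_def moment_def\<close>)
    qed
    also have "(\<Sum>m\<in>S'. s m * moment (fst m + (d - 0 + (9 - d))) (snd m + (0 + 2)) (i - fst m - snd m)) =
      s (1, 1) * moment (fst (1::nat, 1::nat) + (d - 0 + (9 - d))) (snd (1::nat, 1::nat) + (0 + 2)) (i - fst (1::nat, 1::nat) - snd (1::nat, 1::nat))"
    proof (rule single_term)
      show "(1, 1) \<in> S'" using that by (simp add: S'_def)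
      fix m assume m: "m \<in> S'" "m \<noteq> (1, 1)"
      show "s m * moment (fst m + (d - 0 + (9 - d))) (snd m + (0 + 2)) (i - fst m - snd m) = 0"
      proof (cases "fst m + snd m = 2")
        case True
        then show ?thesis using two[OF True] s2 m by auto
      qed (use m \<open>i = 2\<close> in \<open>auto simp: S'_def moment_def\<close>)
    qed
    also have "\<dots> = s (1, 1)" using d that by (simp add: moment_def)
    finally show ?thesis using q0 by simp
  qed
  \<comment> \<open>Here the extra factor \<open>X Y\<close> removes the vertices. It also removes all moments except the one at \<open>X\<^sup>1\<^sup>0 Y\<^sup>3\<close>.\<close>
  have xyy: "s (i - 2, 2) = 0" if "(i - 2, 2) \<in> S" "i \<ge> 3"
  proof -
    have d: "i + d \<le> 11"
      using that(1) unfolding S_def by (cases rule: test_monomials_cases) (use that in auto)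
    have "0 = (\<Sum>t\<in>I. p t * al t * (x t ^ (12 - i - d) * y t ^ 1))"
    proof (intro sum.neutral[symmetric] ballI)
      fix t assume "t \<in> I"
      moreover have "12 - i - d > 0" using d by simp
      ultimately show "p t * al t * (x t ^ (12 - i - d) * y t ^ 1) = 0"
        using p1[of t] al0[of t] by (auto simp: I1_def I0_def)
    qed
    also have "\<dots> = (\<Sum>k\<le>d. coeff q k *
      (\<Sum>m\<in>S'. s m * moment (fst m + (d - k + (12 - i - d))) (snd m + (k + 1)) (i - fst m - snd m)))"
      using d that by (intro pairing_al) simp
    also have "\<dots> = coeff q 0 * (\<Sum>m\<in>S'. s m * moment (fst m + (d - 0 + (12 - i - d))) (snd m + (0 + 1)) (i - fst m - snd m))"
    proof (intro first_term sum.neutral ballI)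
      fix k m assume k: "0 < k" "k \<le> d" and m: "m \<in> S'"
      from m show "s m * moment (fst m + (d - k + (12 - i - d))) (snd m + (k + 1)) (i - fst m - snd m) = 0"
      proof (rule S'_cases)
        fix a assume a: "m = (a, 0)" "a \<le> 10" "a \<le> i"
        show ?thesis
        proof (cases "a = i")
          case True
          then show ?thesis using a x_power m by (auto simp: S'_def)
        next
          case False
          then show ?thesis using a k d by (auto simp: moment_def)
        qed
      qed (use k d that in \<open>auto simp: moment_def\<close>)
    qed
    also have "(\<Sum>m\<in>S'. s m * moment (fst m + (d - 0 + (12 - i - d))) (snd m + (0 + 1)) (i - fst m - snd m)) =
      s (i - 2, 2) * moment (fst (i - 2, 2::nat) + (d - 0 + (12 - i - d))) (snd (i - 2, 2::nat) + (0 + 1)) (i - fst (i - 2, 2::nat) - snd (i - 2, 2::nat))"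
    proof (rule single_term)
      show "(i - 2, 2) \<in> S'" using that by (simp add: S'_def)
      fix m assume "m \<in> S'" "m \<noteq> (i - 2, 2)"
      then show "s m * moment (fst m + (d - 0 + (12 - i - d))) (snd m + (0 + 1)) (i - fst m - snd m) = 0"
        by (elim S'_cases) (use d that in \<open>auto simp: moment_def\<close>)
    qed
    also have "\<dots> = s (i - 2, 2)" using d that by (simp add: moment_def)
    finally show ?thesis using q0 by simp
  qed
  have "m1 = (i, 0) \<or> m1 = (0, i) \<or> m1 = (1, 1) \<and> i = 2 \<or> m1 = (i - 2, 2) \<and> i \<ge> 3"
    using m1(1) unfolding S_def by (cases rule: test_monomials_cases) (use m1(3) in auto)
  then show False
    using m1 x_power y_power xy xyy by auto
qed

section \<open>Ternary forms and powers of linear forms\<close>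

abbreviation mterm :: "monom3 \<Rightarrow> complex \<Rightarrow> poly3" where
  "mterm \<equiv> Poly_Mapping.single"

lemma exhaust_3: "i = 0 \<or> i = 1 \<or> i = 2" for i :: 3
proof (induct i)
  case (of_int z)
  then have "z = 0 \<or> z = 1 \<or> z = 2" by fastforce
  then show ?case by auto
qed

lemma UNIV_3: "(UNIV :: 3 set) = {0, 1, 2}"
  using exhaust_3 by auto

lemma sum_3: "sum f (UNIV :: 3 set) = f 0 + f 1 + f 2"
  unfolding UNIV_3 by (simp add: add.assoc)

lemma prod_3: "prod f (UNIV :: 3 set) = f 0 * f 1 * f 2"
  unfolding UNIV_3 by (simp add: mult.assoc)

text \<open>
Exponent vectors and linear forms with explicit coordinates, so that calculations avoid the index
type \<^typ>\<open>3\<close>.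
\<close>

definition mon :: "nat \<Rightarrow> nat \<Rightarrow> nat \<Rightarrow> monom3" where
  "mon i j k = Poly_Mapping.single 0 i + Poly_Mapping.single 1 j + Poly_Mapping.single 2 k"

definition lin :: "complex \<Rightarrow> complex \<Rightarrow> complex \<Rightarrow> poly3" where
  "lin a b c = mterm (mon 1 0 0) a + mterm (mon 0 1 0) b + mterm (mon 0 0 1) c"

lemma lookup_mon [simp]:
  "Poly_Mapping.lookup (mon i j k) 0 = i"
  "Poly_Mapping.lookup (mon i j k) 1 = j"
  "Poly_Mapping.lookup (mon i j k) 2 = k"
  by (simp_all add: mon_def lookup_add lookup_single)

lemma mon_cases: obtains i j k where "m = mon i j k"
proof
  show "m = mon (Poly_Mapping.lookup m 0) (Poly_Mapping.lookup m 1) (Poly_Mapping.lookup m 2)"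
  proof (rule poly_mapping_eqI)
    fix i :: 3
    show "Poly_Mapping.lookup m i = Poly_Mapping.lookup
      (mon (Poly_Mapping.lookup m 0) (Poly_Mapping.lookup m 1) (Poly_Mapping.lookup m 2)) i"
      using exhaust_3[of i] by (elim disjE) simp_all
  qed
qed

lemma mon_eq_iff [simp]: "mon i j k = mon i' j' k' \<longleftrightarrow> i = i' \<and> j = j' \<and> k = k'"
proof
  assume eq: "mon i j k = mon i' j' k'"
  have "Poly_Mapping.lookup (mon i j k) v = Poly_Mapping.lookup (mon i' j' k') v" for v
    by (simp add: eq)
  from this[of 0] this[of 1] this[of 2] show "i = i' \<and> j = j' \<and> k = k'"
    by simp
qed simp

lemma mon_add: "mon i j k + mon i' j' k' = mon (i + i') (j + j') (k + k')"
proof (rule poly_mapping_eqI)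
  fix v :: 3
  show "Poly_Mapping.lookup (mon i j k + mon i' j' k') v =
      Poly_Mapping.lookup (mon (i + i') (j + j') (k + k')) v"
    using exhaust_3[of v] by (elim disjE) (simp_all add: lookup_add)
qed

lemma mdegree_mon [simp]: "mdegree (mon i j k) = i + j + k"
  unfolding mdegree_def sum_3 by simp

lemma mdegree_add: "mdegree (m + m') = mdegree m + mdegree m'"
  by (simp add: mdegree_def lookup_add sum.distrib)

lemma lookup_cscale [simp]: "Poly_Mapping.lookup (cscale c p) m = c * Poly_Mapping.lookup p m"
proof -
  have "cscale c p = Poly_Mapping.map ((*) c) p"
    by (simp add: cscale_def mult_map_scale_conv_mult)
  then show ?thesis by (simp add: Poly_Mapping.map.rep_eq when_def)
qed

lemma poly_eq_sum_mterm: "p = (\<Sum>m\<in>Poly_Mapping.keys p. mterm m (Poly_Mapping.lookup p m))"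
  by (rule poly_mapping_eqI) (simp add: lookup_sum lookup_single when_def in_keys_iff)

lemma cscale_mterm: "cscale c (mterm m a) = mterm m (c * a)"
  by (simp add: cscale_def mult_single)

lemma lookup_mterm_mult:
  "Poly_Mapping.lookup (mterm m a * p) (m + m') = a * Poly_Mapping.lookup p m'"
proof -
  have "mterm m a * p = (\<Sum>k\<in>Poly_Mapping.keys p. mterm (m + k) (a * Poly_Mapping.lookup p k))"
    by (subst (1) poly_eq_sum_mterm[of p]) (simp add: sum_distrib_left mult_single)
  then show ?thesis
    by (simp add: lookup_sum lookup_single when_def in_keys_iff)
qed

lemma graded_piece_subspace: "cvs.subspace (graded_piece d)"
proof (rule cvs.subspaceI)
  fix p q assume "p \<in> graded_piece d" "q \<in> graded_piece d"
  then show "p + q \<in> graded_piece d"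
    unfolding graded_piece_def using keys_add[of p q] by blast
next
  fix c p assume p: "p \<in> graded_piece d"
  have "Poly_Mapping.keys (cscale c p) \<subseteq> Poly_Mapping.keys p"
    by (auto simp: in_keys_iff)
  then show "cscale c p \<in> graded_piece d"
    using p unfolding graded_piece_def by blast
qed (simp add: graded_piece_def)

lemma mterm_in_graded_piece: "int (mdegree m) = d \<Longrightarrow> mterm m a \<in> graded_piece d"
  by (auto simp: graded_piece_def split: if_splits)

lemma graded_piece_mult:
  assumes "p \<in> graded_piece d" "q \<in> graded_piece e"
  shows "p * q \<in> graded_piece (d + e)"
  unfolding graded_piece_def
proof (intro CollectI ballI)
  fix m assume "m \<in> Poly_Mapping.keys (p * q)"
  then obtain m1 m2 where "m = m1 + m2" "m1 \<in> Poly_Mapping.keys p" "m2 \<in> Poly_Mapping.keys q"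
    using keys_mult[of p q] by blast
  then show "int (mdegree m) = d + e"
    using assms by (auto simp: graded_piece_def mdegree_add)
qed

lemma lin_in_graded_piece: "lin a b c \<in> graded_piece 1"
  unfolding lin_def
  by (intro cvs.subspace_add[OF graded_piece_subspace] mterm_in_graded_piece) simp_all

lemma lookup_lin:
  "Poly_Mapping.lookup (lin a b c) (mon 1 0 0) = a"
  "Poly_Mapping.lookup (lin a b c) (mon 0 1 0) = b"
  "Poly_Mapping.lookup (lin a b c) (mon 0 0 1) = c"
  by (simp_all add: lin_def lookup_add lookup_single)

lemma graded_piece_1_cases:
  assumes "l \<in> graded_piece 1"
  obtains a b c where "l = lin a b c"
proof
  let ?L = "Poly_Mapping.lookup l"
  show "l = lin (?L (mon 1 0 0)) (?L (mon 0 1 0)) (?L (mon 0 0 1))" (is "_ = ?r")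
  proof (rule poly_mapping_eqI)
    fix m
    obtain i j k where m: "m = mon i j k" by (rule mon_cases)
    show "?L m = Poly_Mapping.lookup ?r m"
    proof (cases "i + j + k = 1")
      case True
      then have "i = 1 \<and> j = 0 \<and> k = 0 \<or> i = 0 \<and> j = 1 \<and> k = 0 \<or> i = 0 \<and> j = 0 \<and> k = 1"
        by linarith
      then show ?thesis unfolding m by (elim disjE conjE) (simp_all add: lookup_lin[simplified])
    next
      case False
      then have "m \<notin> Poly_Mapping.keys l" "m \<notin> Poly_Mapping.keys ?r"
        using assms lin_in_graded_piece[of "?L (mon 1 0 0)" "?L (mon 0 1 0)" "?L (mon 0 0 1)"]
        by (auto simp: graded_piece_def m)
      then show ?thesis by (simp add: in_keys_iff)
    qed
  qed
qed

lemma coords_lin [simp]: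
  "coords (lin a b c) 0 = a" "coords (lin a b c) 1 = b" "coords (lin a b c) 2 = c"
proof -
  have "mon 1 0 0 = Poly_Mapping.single 0 1" "mon 0 1 0 = Poly_Mapping.single 1 1"
    "mon 0 0 1 = Poly_Mapping.single 2 1"
    unfolding mon_def single_zero by (simp_all only: add_0 add_0_right)
  then show "coords (lin a b c) 0 = a" "coords (lin a b c) 1 = b" "coords (lin a b c) 2 = c"
    using lookup_lin[of a b c] unfolding coords_def by (simp_all only:)
qed

lemma lin_eq_iff [simp]: "lin a b c = lin a' b' c' \<longleftrightarrow> a = a' \<and> b = b' \<and> c = c'"
proof
  assume eq: "lin a b c = lin a' b' c'"
  show "a = a' \<and> b = b' \<and> c = c'"
    using arg_cong[OF eq, of "\<lambda>l. coords l 0"] arg_cong[OF eq, of "\<lambda>l. coords l 1"]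
      arg_cong[OF eq, of "\<lambda>l. coords l 2"]
    unfolding coords_lin by blast
qed simp

lemma cscale_lin: "cscale t (lin a b c) = lin (t * a) (t * b) (t * c)"
  by (simp add: lin_def cvs.scale_right_distrib cscale_mterm)

lemma lin_eq_0_iff: "lin a b c = 0 \<longleftrightarrow> a = 0 \<and> b = 0 \<and> c = 0"
proof -
  have "lin 0 0 0 = 0" by (simp add: lin_def)
  then show ?thesis using lin_eq_iff[of a b c 0 0 0] by simp
qed

definition multinomial3 :: "nat \<Rightarrow> nat \<Rightarrow> nat \<Rightarrow> complex" where
  "multinomial3 i j k = fact (i + j + k) / (fact i * fact j * fact k)"

lemma multinomial3_nonzero [simp]: "multinomial3 i j k \<noteq> 0"
  by (simp add: multinomial3_def)

lemma lookup_mterm_mult_0: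
  assumes "\<not> (\<exists>m'. m = n + m')"
  shows "Poly_Mapping.lookup (mterm n a * p) m = 0"
proof -
  have "m \<notin> Poly_Mapping.keys (mterm n a * p)"
    using keys_mult[of "mterm n a" p] assms by (auto split: if_splits)
  then show ?thesis by (simp add: in_keys_iff)
qed

lemma lookup_x_mult:
  "Poly_Mapping.lookup (mterm (mon 1 0 0) a * p) (mon i j k) =
    (if i = 0 then 0 else a * Poly_Mapping.lookup p (mon (i - 1) j k))"
  "Poly_Mapping.lookup (mterm (mon 0 1 0) a * p) (mon i j k) =
    (if j = 0 then 0 else a * Poly_Mapping.lookup p (mon i (j - 1) k))"
  "Poly_Mapping.lookup (mterm (mon 0 0 1) a * p) (mon i j k) =
    (if k = 0 then 0 else a * Poly_Mapping.lookup p (mon i j (k - 1)))"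
proof -
  have no: "\<not> (\<exists>m'. mon 0 j k = mon 1 0 0 + m')" "\<not> (\<exists>m'. mon i 0 k = mon 0 1 0 + m')"
    "\<not> (\<exists>m'. mon i j 0 = mon 0 0 1 + m')"
    by (metis mon_cases mon_add mon_eq_iff add_is_0 one_neq_zero)+
  show "Poly_Mapping.lookup (mterm (mon 1 0 0) a * p) (mon i j k) =
      (if i = 0 then 0 else a * Poly_Mapping.lookup p (mon (i - 1) j k))"
    using lookup_mterm_mult[of "mon 1 0 0" a p "mon (i - 1) j k"] lookup_mterm_mult_0[OF no(1)]
    by (cases i) (simp_all add: mon_add)
  show "Poly_Mapping.lookup (mterm (mon 0 1 0) a * p) (mon i j k) =
      (if j = 0 then 0 else a * Poly_Mapping.lookup p (mon i (j - 1) k))"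
    using lookup_mterm_mult[of "mon 0 1 0" a p "mon i (j - 1) k"] lookup_mterm_mult_0[OF no(2)]
    by (cases j) (simp_all add: mon_add)
  show "Poly_Mapping.lookup (mterm (mon 0 0 1) a * p) (mon i j k) =
      (if k = 0 then 0 else a * Poly_Mapping.lookup p (mon i j (k - 1)))"
    using lookup_mterm_mult[of "mon 0 0 1" a p "mon i j (k - 1)"] lookup_mterm_mult_0[OF no(3)]
    by (cases k) (simp_all add: mon_add)
qed

text \<open>
The multinomial theorem for three summands, by the Pascal-type recurrence that multiplication by the
linear form induces on coefficients.
\<close>

lemma lookup_lin_power:
  "Poly_Mapping.lookup (lin a b c ^ n) (mon i j k) =
    (if i + j + k = n then multinomial3 i j k * (a ^ i * b ^ j * c ^ k) else 0)"
proof (induction n arbitrary: i j k)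
  case 0
  have "mon i j k = 0 \<longleftrightarrow> i = 0 \<and> j = 0 \<and> k = 0"
    using mon_eq_iff[of i j k 0 0 0] by (simp add: mon_def)
  then show ?case by (auto simp: lookup_one when_def multinomial3_def)
next
  case (Suc n)
  have step: "Poly_Mapping.lookup (lin a b c ^ Suc n) (mon i j k) =
      (if i = 0 then 0 else a * Poly_Mapping.lookup (lin a b c ^ n) (mon (i - 1) j k)) +
      (if j = 0 then 0 else b * Poly_Mapping.lookup (lin a b c ^ n) (mon i (j - 1) k)) +
      (if k = 0 then 0 else c * Poly_Mapping.lookup (lin a b c ^ n) (mon i j (k - 1)))"
    by (simp only: power_Suc lin_def[of a b c] distrib_right lookup_add lookup_x_mult)
  show ?case
  proof (cases "i + j + k = Suc n")
    case False
    have "(if i = 0 then 0 else a * Poly_Mapping.lookup (lin a b c ^ n) (mon (i - 1) j k)) = 0"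
      using False Suc.IH[of "i - 1" j k] by (cases i) simp_all
    moreover have "(if j = 0 then 0 else b * Poly_Mapping.lookup (lin a b c ^ n) (mon i (j - 1) k)) = 0"
      using False Suc.IH[of i "j - 1" k] by (cases j) simp_all
    moreover have "(if k = 0 then 0 else c * Poly_Mapping.lookup (lin a b c ^ n) (mon i j (k - 1))) = 0"
      using False Suc.IH[of i j "k - 1"] by (cases k) simp_all
    ultimately show ?thesis using False unfolding step by (simp only: if_False) simp
  next
    case True
    define M where "M = fact n / (fact i * fact j * fact k) * (a ^ i * b ^ j * c ^ k)"
    have cancel: "u * (F / (u * f) * X) = F / f * X" if "u \<noteq> 0" for u F f X :: complex
      using that by simp
    have "(if i = 0 then 0 else a * Poly_Mapping.lookup (lin a b c ^ n) (mon (i - 1) j k)) = of_nat i * M"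
    proof (cases i)
      case (Suc m)
      then have "of_nat i * M = of_nat (Suc m) *
          (fact n / (of_nat (Suc m) * (fact m * fact j * fact k)) * (a * (a ^ m * b ^ j * c ^ k)))"
        by (simp only: M_def fact_Suc power_Suc mult.assoc)
      also have "\<dots> = a * (multinomial3 m j k * (a ^ m * b ^ j * c ^ k))"
        using True Suc by (subst cancel) (simp_all add: multinomial3_def del: of_nat_Suc)
      finally show ?thesis using True Suc by (simp add: Suc.IH)
    qed simp
    moreover have "(if j = 0 then 0 else b * Poly_Mapping.lookup (lin a b c ^ n) (mon i (j - 1) k)) = of_nat j * M"
    proof (cases j)
      case (Suc m)
      then have "of_nat j * M = of_nat (Suc m) *
          (fact n / (of_nat (Suc m) * (fact i * fact m * fact k)) * (b * (a ^ i * b ^ m * c ^ k)))"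
        by (simp only: M_def fact_Suc power_Suc mult_ac)
      also have "\<dots> = b * (multinomial3 i m k * (a ^ i * b ^ m * c ^ k))"
        using True Suc by (subst cancel) (simp_all add: multinomial3_def del: of_nat_Suc)
      finally show ?thesis using True Suc by (simp add: Suc.IH)
    qed simp
    moreover have "(if k = 0 then 0 else c * Poly_Mapping.lookup (lin a b c ^ n) (mon i j (k - 1))) = of_nat k * M"
    proof (cases k)
      case (Suc m)
      then have "of_nat k * M = of_nat (Suc m) *
          (fact n / (of_nat (Suc m) * (fact i * fact j * fact m)) * (c * (a ^ i * b ^ j * c ^ m)))"
        by (simp only: M_def fact_Suc power_Suc mult_ac)
      also have "\<dots> = c * (multinomial3 i j m * (a ^ i * b ^ j * c ^ m))"
        using True Suc by (subst cancel) (simp_all add: multinomial3_def del: of_nat_Suc)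
      finally show ?thesis using True Suc by (simp add: Suc.IH)
    qed simp
    ultimately have "Poly_Mapping.lookup (lin a b c ^ Suc n) (mon i j k) = of_nat (i + j + k) * M"
      unfolding step of_nat_add by (simp only: distrib_right)
    also have "\<dots> = multinomial3 i j k * (a ^ i * b ^ j * c ^ k)"
      using True by (simp add: M_def multinomial3_def del: of_nat_Suc)
    finally show ?thesis using True by simp
  qed
qed

section \<open>Thirty points on the sides of a triangle\<close>

definition ternary_form :: poly3 where
  "ternary_form = mterm (mon 10 3 0) 286 + mterm (mon 10 0 3) 286 +
    mterm (mon 0 10 3) 286 + mterm (mon 0 13 0) 1"

lemma lookup_ternary_form:
  "Poly_Mapping.lookup ternary_form (mon i j k) =
    (if i + j + k = 13 then multinomial3 i j k * moment i j k else 0)"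
proof -
  have "multinomial3 10 3 0 = 286" "multinomial3 10 0 3 = 286" "multinomial3 0 10 3 = 286"
    "multinomial3 0 13 0 = 1"
    by (simp_all add: multinomial3_def fact_numeral)
  then show ?thesis
    by (auto simp: ternary_form_def lookup_add lookup_single when_def moment_def)
qed

lemma ternary_form_in_graded_piece: "ternary_form \<in> graded_piece 13"
  unfolding ternary_form_def
  by (intro cvs.subspace_add[OF graded_piece_subspace] mterm_in_graded_piece) simp_all

lemma ternary_form_nonzero: "ternary_form \<noteq> 0"
proof
  assume "ternary_form = 0"
  then show False
    using lookup_ternary_form[of 10 3 0] by (simp add: moment_def)
qed

lemma cscale_sum_right: "cscale c (sum f A) = (\<Sum>a\<in>A. cscale c (f a))"
  by (rule cvs.scale_sum_right)

lemma cscale_power: "cscale c l ^ d = cscale (c ^ d) (l ^ d)"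
proof -
  have "mterm 0 c ^ d = mterm 0 (c ^ d)"
    by (induction d) (simp_all add: mult_single)
  then show ?thesis
    by (simp add: cscale_def power_mult_distrib)
qed

lemma waring_decomposition_ge_30:
  fixes l :: "nat \<Rightarrow> poly3"
  assumes "\<forall>i<r. l i \<in> graded_piece 1" "ternary_form = (\<Sum>i<r. l i ^ 13)"
  shows "r \<ge> 30"
proof -
  define x where "x i = coords (l i) 0" for i
  define y where "y i = coords (l i) 1" for i
  define z where "z i = coords (l i) 2" for i
  have l: "l i = lin (x i) (y i) (z i)" if "i < r" for i
    using assms(1) that by (metis graded_piece_1_cases coords_lin x_def y_def z_def)
  have "card {..<r} \<ge> 30"
  proof (rule moment_rank_bound)
    fix i j k :: nat assume ijk: "i + j + k = 13"
    have "multinomial3 i j k * moment i j k = Poly_Mapping.lookup ternary_form (mon i j k)"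
      using ijk by (simp add: lookup_ternary_form)
    also have "\<dots> = (\<Sum>t<r. Poly_Mapping.lookup (lin (x t) (y t) (z t) ^ 13) (mon i j k))"
      by (simp add: assms(2) lookup_sum l)
    also have "\<dots> = multinomial3 i j k * (\<Sum>t<r. x t ^ i * y t ^ j * z t ^ k)"
      using ijk by (simp add: lookup_lin_power sum_distrib_left)
    finally show "(\<Sum>t<r. x t ^ i * y t ^ j * z t ^ k) = moment i j k"
      by simp
  qed simp
  then show ?thesis by simp
qed

lemma span_image_explicit:
  assumes "f \<in> cvs.span (g ` B)" "finite B"
  shows "\<exists>u. f = (\<Sum>l\<in>B. cscale (u l) (g l))"
proof -
  let ?V = "range (\<lambda>u. \<Sum>l\<in>B. cscale (u l) (g l))"
  have "cvs.span (g ` B) \<subseteq> ?V"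
  proof (rule cvs.span_minimal)
    show "g ` B \<subseteq> ?V"
    proof
      fix v assume "v \<in> g ` B"
      then obtain b where b: "b \<in> B" "v = g b" by blast
      have "(\<Sum>l\<in>B. cscale (of_bool (l = b)) (g l)) = (\<Sum>l\<in>B. if l = b then g l else 0)"
        by (rule sum.cong) auto
      also have "\<dots> = v" using b assms by simp
      finally show "v \<in> ?V" by (intro range_eqI[where x = "\<lambda>l. of_bool (l = b)"]) (rule sym)
    qed
    show "cvs.subspace ?V"
    proof (rule cvs.subspaceI)
      show "0 \<in> ?V" by (intro range_eqI[where x = "\<lambda>_. 0"]) simp
    next
      fix v w assume "v \<in> ?V" "w \<in> ?V"
      then obtain s t where "v = (\<Sum>l\<in>B. cscale (s l) (g l))" "w = (\<Sum>l\<in>B. cscale (t l) (g l))" by blast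
      then have "v + w = (\<Sum>l\<in>B. cscale (s l + t l) (g l))"
        by (simp add: cvs.scale_left_distrib sum.distrib)
      then show "v + w \<in> ?V" by (intro range_eqI[where x = "\<lambda>l. s l + t l"])
    next
      fix c v assume "v \<in> ?V"
      then obtain s where "v = (\<Sum>l\<in>B. cscale (s l) (g l))" by blast
      then have "cscale c v = (\<Sum>l\<in>B. cscale (c * s l) (g l))"
        by (simp add: cscale_sum_right)
      then show "cscale c v \<in> ?V" by (intro range_eqI[where x = "\<lambda>l. c * s l"])
    qed
  qed
  then show ?thesis using assms(1) by blast
qed

text \<open>
Over the complex numbers the coefficients of a linear combination of powers can be absorbed into the
linear forms, because \<open>d\<close>-th roots exist.
\<close>

lemma waring_decomposition_of_span:
  assumes "finite B" "B \<subseteq> graded_piece 1" "f \<in> cvs.span ((\<lambda>l. l ^ d) ` B)" "d > 0"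
  shows "\<exists>l :: nat \<Rightarrow> poly3. (\<forall>i<card B. l i \<in> graded_piece 1) \<and> f = (\<Sum>i<card B. l i ^ d)"
proof -
  obtain u where u: "f = (\<Sum>l\<in>B. cscale (u l) (l ^ d))"
    using span_image_explicit[OF assms(3,1)] by blast
  have "\<exists>w. w ^ d = c" for c :: complex
  proof (cases "c = 0")
    case True
    then show ?thesis using assms(4) by (intro exI[of _ 0]) (simp add: zero_power)
  next
    case False
    then have "card {w. w ^ d = c} \<noteq> 0" using card_nth_roots[of c d] assms(4) by simp
    then have "{w. w ^ d = c} \<noteq> {}" by (intro notI) (simp only: card.empty simp_thms)
    then show ?thesis by blast
  qed
  then have "\<exists>w. \<forall>c. w c ^ d = (c :: complex)" by (intro choice allI)
  then obtain w where w: "w c ^ d = c" for c :: complex by blast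
  obtain h where h: "bij_betw h {..<card B} B"
    using ex_bij_betw_nat_finite[OF assms(1)] by (auto simp: atLeast0LessThan)
  let ?l = "\<lambda>i. cscale (w (u (h i))) (h i)"
  have "f = (\<Sum>i<card B. ?l i ^ d)"
    unfolding u cscale_power w by (rule sum.reindex_bij_betw[OF h, symmetric])
  moreover have "\<forall>i<card B. ?l i \<in> graded_piece 1"
  proof (intro allI impI)
    fix i assume "i < card B"
    then have "h i \<in> graded_piece 1" using bij_betwE[OF h] assms(2) by auto
    then show "?l i \<in> graded_piece 1" by (rule cvs.subspace_scale[OF graded_piece_subspace])
  qed
  ultimately show ?thesis by (intro exI[of _ ?l] conjI)
qed

lemma apolar_proj_point_image:
  assumes "f \<in> cvs.span ((\<lambda>l. l ^ d) ` B)" "f \<noteq> 0"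
  shows "apolar d (proj_point ` B) f"
proof -
  have "(\<lambda>l. l ^ d) ` B \<subseteq> \<Union> (veronese d ` proj_point ` B)"
  proof
    fix v assume "v \<in> (\<lambda>l. l ^ d) ` B"
    then obtain l where l: "l \<in> B" "v = l ^ d" by blast
    have "v \<in> veronese d (proj_point l)"
      unfolding veronese_proj_point l(2) by (simp add: proj_point_def cvs.span_base)
    then show "v \<in> \<Union> (veronese d ` proj_point ` B)" using l by blast
  qed
  then have "f \<in> cvs.span (\<Union> (veronese d ` proj_point ` B))"
    using assms(1) cvs.span_mono by blast
  then show ?thesis
    using assms(2) by (auto simp: apolar_def proj_span_def proj_def)
qed

text \<open>
The points of the sides \<open>Z = 0\<close>, \<open>Y = 0\<close> and \<open>X = 0\<close>, in this order, with affine coordinates from the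
given sets. If none of these contains \<open>0\<close>, then no vertex of the triangle occurs, and distinct linear
forms give distinct points.
\<close>

definition triangle_points :: "complex set \<Rightarrow> complex set \<Rightarrow> complex set \<Rightarrow> poly3 set" where
  "triangle_points T1 T2 T3 =
    (\<lambda>t. lin 1 t 0) ` T1 \<union> (\<lambda>t. lin 1 0 t) ` T2 \<union> (\<lambda>t. lin 0 t 1) ` T3"

lemma triangle_points_linear: "triangle_points T1 T2 T3 \<subseteq> graded_piece 1 - {0}"
  by (auto simp: triangle_points_def lin_in_graded_piece lin_eq_0_iff)

lemma sum_triangle_points:
  assumes "finite T1" "finite T2" "finite T3" "0 \<notin> T1" "0 \<notin> T2"
  shows "(\<Sum>l\<in>triangle_points T1 T2 T3. g l) =
    (\<Sum>t\<in>T1. g (lin 1 t 0)) + (\<Sum>t\<in>T2. g (lin 1 0 t)) + (\<Sum>t\<in>T3. g (lin 0 t 1))"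
proof -
  let ?A = "(\<lambda>t. lin 1 t 0) ` T1" and ?B = "(\<lambda>t. lin 1 0 t) ` T2" and ?C = "(\<lambda>t. lin 0 t 1) ` T3"
  have disj: "?A \<inter> ?B = {}" "(?A \<union> ?B) \<inter> ?C = {}"
    using assms(4,5) by auto
  have fin: "finite ?A" "finite ?B" "finite (?A \<union> ?B)" "finite ?C"
    using assms by simp_all
  have "inj_on (\<lambda>t. lin 1 t 0) T1" "inj_on (\<lambda>t. lin 1 0 t) T2" "inj_on (\<lambda>t. lin 0 t 1) T3"
    by (simp_all add: inj_on_def)
  then have "sum g ?A = (\<Sum>t\<in>T1. g (lin 1 t 0))" "sum g ?B = (\<Sum>t\<in>T2. g (lin 1 0 t))"
    "sum g ?C = (\<Sum>t\<in>T3. g (lin 0 t 1))"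
    by (simp_all add: sum.reindex)
  then show ?thesis
    unfolding triangle_points_def sum.union_disjoint[OF fin(3,4) disj(2)]
      sum.union_disjoint[OF fin(1,2) disj(1)] by (simp only:)
qed

lemma finite_triangle_points:
  "finite T1 \<Longrightarrow> finite T2 \<Longrightarrow> finite T3 \<Longrightarrow> finite (triangle_points T1 T2 T3)"
  by (simp add: triangle_points_def)

lemma card_triangle_points:
  assumes "finite T1" "finite T2" "finite T3" "0 \<notin> T1" "0 \<notin> T2"
  shows "card (triangle_points T1 T2 T3) = card T1 + card T2 + card T3"
  using sum_triangle_points[OF assms, of "\<lambda>_. 1 :: nat"] by simp

lemma proj_point_eq_imp: "proj_point l = proj_point l' \<Longrightarrow> \<exists>k. l = cscale k l'"
  using cvs.span_base[of l "{l}"] by (auto simp: proj_point_def cvs.span_singleton)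

lemma inj_on_proj_point_triangle_points:
  assumes "0 \<notin> T1" "0 \<notin> T2" "0 \<notin> T3"
  shows "inj_on proj_point (triangle_points T1 T2 T3)"
proof (rule inj_onI)
  fix l l' assume l: "l \<in> triangle_points T1 T2 T3" "l' \<in> triangle_points T1 T2 T3"
    and "proj_point l = proj_point l'"
  then obtain k where "l = cscale k l'" using proj_point_eq_imp by blast
  then show "l = l'"
    using l assms by (auto simp: triangle_points_def cscale_lin)
qed

text \<open>
The moments are distributed over the three sides. Apart from the vertices this is forced. At the vertex
\<open>z\<close> the sides contribute \<open>-1\<close> and \<open>1\<close>, and at the vertex \<open>y\<close> they contribute \<open>n\<close> and \<open>1 - n\<close>; the choice of
\<open>n\<close> is the freedom that produces different decompositions.
\<close>

lemma ternary_form_in_span_triangle: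
  assumes "finite T1" "finite T2" "finite T3"
    and c1: "\<And>j. j \<le> 13 \<Longrightarrow> (\<Sum>t\<in>T1. c1 t * t ^ j) = of_bool (j = 3) + n * of_bool (j = 13)"
    and c2: "\<And>j. j \<le> 13 \<Longrightarrow> (\<Sum>t\<in>T2. c2 t * t ^ j) = of_bool (j = 3) - of_bool (j = 13)"
    and c3: "\<And>j. j \<le> 13 \<Longrightarrow> (\<Sum>t\<in>T3. c3 t * t ^ j) =
      of_bool (j = 0) + of_bool (j = 10) + (1 - n) * of_bool (j = 13)"
  shows "ternary_form \<in> cvs.span ((\<lambda>l. l ^ 13) ` triangle_points T1 T2 T3)"
proof -
  have "ternary_form = (\<Sum>t\<in>T1. cscale (c1 t) (lin 1 t 0 ^ 13)) +
      (\<Sum>t\<in>T2. cscale (c2 t) (lin 1 0 t ^ 13)) + (\<Sum>t\<in>T3. cscale (c3 t) (lin 0 t 1 ^ 13))"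
    (is "_ = ?r")
  proof (rule poly_mapping_eqI)
    fix m
    obtain i j k where m: "m = mon i j k" by (rule mon_cases)
    show "Poly_Mapping.lookup ternary_form m = Poly_Mapping.lookup ?r m"
    proof (cases "i + j + k = 13")
      case True
      have "Poly_Mapping.lookup ?r m = multinomial3 i j k *
          ((\<Sum>t\<in>T1. c1 t * t ^ j) * 0 ^ k + (\<Sum>t\<in>T2. c2 t * t ^ k) * 0 ^ j +
           (\<Sum>t\<in>T3. c3 t * t ^ j) * 0 ^ i)"
        using True unfolding m
        by (simp add: lookup_add lookup_sum lookup_lin_power distrib_left sum_distrib_left
            sum_distrib_right mult_ac)
      also have "(\<Sum>t\<in>T1. c1 t * t ^ j) * 0 ^ k + (\<Sum>t\<in>T2. c2 t * t ^ k) * 0 ^ j +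
           (\<Sum>t\<in>T3. c3 t * t ^ j) * 0 ^ i = moment i j k"
        using True by (subst c1, simp, subst c2, simp, subst c3)
          (auto simp: moment_def power_0_left)
      finally show ?thesis using True by (simp add: m lookup_ternary_form)
    next
      case False
      then show ?thesis unfolding m
        by (simp add: lookup_add lookup_sum lookup_lin_power lookup_ternary_form)
    qed
  qed
  moreover have "?r \<in> cvs.span ((\<lambda>l. l ^ 13) ` triangle_points T1 T2 T3)"
    by (intro cvs.span_add cvs.span_sum cvs.span_scale cvs.span_base)
      (auto simp: triangle_points_def)
  ultimately show ?thesis by simp
qed

lemma computes_rank_triangle_points:
  assumes fin: "finite T1" "finite T2" "finite T3" and nz: "0 \<notin> T1" "0 \<notin> T2" "0 \<notin> T3"
    and card: "card T1 = 10" "card T2 = 10" "card T3 = 10"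
    and span: "ternary_form \<in> cvs.span ((\<lambda>l. l ^ 13) ` triangle_points T1 T2 T3)"
  shows "waring_rank 13 ternary_form = 30"
    and "computes_rank 13 (proj_point ` triangle_points T1 T2 T3) ternary_form"
proof -
  let ?B = "triangle_points T1 T2 T3"
  have B: "finite ?B" "card ?B = 30"
    using fin nz card by (simp_all add: finite_triangle_points card_triangle_points)
  have "\<exists>l :: nat \<Rightarrow> poly3. (\<forall>i<30. l i \<in> graded_piece 1) \<and> ternary_form = (\<Sum>i<30. l i ^ 13)"
    using waring_decomposition_of_span[OF B(1) _ span] triangle_points_linear[of T1 T2 T3] B(2)
    by (auto simp: subset_Diff_insert)
  then show rank: "waring_rank 13 ternary_form = 30"
    unfolding waring_rank_def
    by (intro Least_equality) (use waring_decomposition_ge_30 in blast)+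
  have "card (proj_point ` ?B) = 30"
    using card_image[OF inj_on_proj_point_triangle_points[OF nz]] B by simp
  moreover have "proj_point ` ?B \<subseteq> proj (graded_piece 1)"
    using triangle_points_linear[of T1 T2 T3] unfolding proj_def by (rule image_mono)
  ultimately show "computes_rank 13 (proj_point ` ?B) ternary_form"
    using B rank apolar_proj_point_image[OF span ternary_form_nonzero]
    by (simp add: computes_rank_def)
qed

lemma nat_le_13_cases:
  fixes j :: nat
  assumes "j \<le> 13"
  shows "j \<in> {0,1,2,3,4,5,6,7,8,9,10,11,12,13}"
proof -
  have "[0..<14] = [0,1,2,3,4,5,6,7,8,9,10,11,12,13]" by code_simp
  then have "set [0..<14] = {0,1,2,3,4,5,6,7,8,9,10,11,12,13}" by (simp only: list.set)
  moreover have "j \<in> set [0..<14]" using assms by (simp only: set_upt atLeastLessThan_iff) linarith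
  ultimately show ?thesis by (simp only:)
qed

text \<open>
The points of the triangle on the curve \<open>X\<^sup>1\<^sup>0 - Y\<^sup>1\<^sup>0 + Z\<^sup>1\<^sup>0 = 0\<close>; they belong to the value \<open>n = 1\<close> above.
\<close>

definition section_points :: "poly3 set" where
  "section_points = triangle_points {t. t ^ 10 = 1} {t. t ^ 10 = -1} {t. t ^ 10 = 1}"

text \<open>
The value \<open>n = 2\<close>. On the side \<open>X = 0\<close> the coordinates must be the roots of a polynomial
\<open>t\<^sup>1\<^sup>0 + t\<^sup>7 + \<dots> - 1\<close> without terms of degree 9 and 8, the remaining coefficients being free. They are chosen
such that it is \<open>(t\<^sup>3 + 1) (t\<^sup>7 - 1)\<close>, whose roots are explicit.
\<close>

definition nonsection_points :: "poly3 set" where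
  "nonsection_points = triangle_points {t. t ^ 10 = 2} {t. t ^ 10 = -1} ({t. t ^ 3 = -1} \<union> {t. t ^ 7 = 1})"

lemma ternary_form_in_span_section: "ternary_form \<in> cvs.span ((\<lambda>l. l ^ 13) ` section_points)"
proof -
  have ne: "(0::nat) < 10" "(1::complex) \<noteq> 0" "(-1::complex) \<noteq> 0" by simp_all
  obtain c1 where c1:
    "\<forall>j. (\<Sum>t | t ^ 10 = (1::complex). c1 t * t ^ j) = of_bool (j mod 10 = 3) * 1 ^ (j div 10)"
    using nth_roots_moments[OF ne(1,2), of "\<lambda>a. of_bool (a = 3)"] by blast
  obtain c2 where c2:
    "\<forall>j. (\<Sum>t | t ^ 10 = (-1::complex). c2 t * t ^ j) = of_bool (j mod 10 = 3) * (-1) ^ (j div 10)"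
    using nth_roots_moments[OF ne(1,3), of "\<lambda>a. of_bool (a = 3)"] by blast
  obtain c3 where c3:
    "\<forall>j. (\<Sum>t | t ^ 10 = (1::complex). c3 t * t ^ j) = of_bool (j mod 10 = 0) * 1 ^ (j div 10)"
    using nth_roots_moments[OF ne(1,2), of "\<lambda>a. of_bool (a = 0)"] by blast
  note c = c1[rule_format] c2[rule_format] c3[rule_format]
  show ?thesis
    unfolding section_points_def
  proof (rule ternary_form_in_span_triangle[where n = 1])
    fix j :: nat assume "j \<le> 13"
    then have j: "j \<in> {0,1,2,3,4,5,6,7,8,9,10,11,12,13}" by (rule nat_le_13_cases)
    show "(\<Sum>t | t ^ 10 = 1. c1 t * t ^ j) = of_bool (j = 3) + 1 * of_bool (j = 13)"
      using j unfolding c by (elim insertE emptyE; simp)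
    show "(\<Sum>t | t ^ 10 = -1. c2 t * t ^ j) = of_bool (j = 3) - of_bool (j = 13)"
      using j unfolding c by (elim insertE emptyE; simp)
    show "(\<Sum>t | t ^ 10 = 1. c3 t * t ^ j) = of_bool (j = 0) + of_bool (j = 10) + (1 - 1) * of_bool (j = 13)"
      using j unfolding c by (elim insertE emptyE; simp)
  qed (simp_all only: finite_nth_roots finite_Un zero_less_numeral simp_thms)
qed

lemma cube_septic_roots_disjoint: "{t::complex. t ^ 3 = -1} \<inter> {t. t ^ 7 = 1} = {}"
proof -
  have "False" if "t ^ 3 = -1" "t ^ 7 = 1" for t :: complex
  proof -
    have "t ^ 7 = (t ^ 3) ^ 2 * t" by (simp flip: power_mult power_Suc2)
    then have "t = 1" using that by simp
    then show False using that by simp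
  qed
  then show ?thesis by blast
qed

lemma ternary_form_in_span_nonsection: "ternary_form \<in> cvs.span ((\<lambda>l. l ^ 13) ` nonsection_points)"
proof -
  \<comment> \<open>The initial values solve the linear system which says that the two sequences, with periods 3 up to sign and 7, add up to the moments required on the side \<open>X = 0\<close>.\<close>
  let ?A = "\<lambda>a::nat. if a = 0 then 1/2 else -1/2 :: complex"
  let ?B = "\<lambda>a::nat. if a \<le> 3 then 1/2 else -1/2 :: complex"
  have ne: "(0::nat) < 10" "(0::nat) < 3" "(0::nat) < 7" "(1::complex) \<noteq> 0" "(-1::complex) \<noteq> 0"
    "(2::complex) \<noteq> 0" by simp_all
  obtain c1 where c1:
    "\<forall>j. (\<Sum>t | t ^ 10 = (2::complex). c1 t * t ^ j) = of_bool (j mod 10 = 3) * 2 ^ (j div 10)"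
    using nth_roots_moments[OF ne(1,6), of "\<lambda>a. of_bool (a = 3)"] by blast
  obtain c2 where c2:
    "\<forall>j. (\<Sum>t | t ^ 10 = (-1::complex). c2 t * t ^ j) = of_bool (j mod 10 = 3) * (-1) ^ (j div 10)"
    using nth_roots_moments[OF ne(1,5), of "\<lambda>a. of_bool (a = 3)"] by blast
  obtain a where a:
    "\<forall>j. (\<Sum>t | t ^ 3 = (-1::complex). a t * t ^ j) = ?A (j mod 3) * (-1) ^ (j div 3)"
    using nth_roots_moments[OF ne(2,5), of ?A] by blast
  obtain b where b:
    "\<forall>j. (\<Sum>t | t ^ 7 = (1::complex). b t * t ^ j) = ?B (j mod 7) * 1 ^ (j div 7)"
    using nth_roots_moments[OF ne(3,4), of ?B] by blast
  note c = c1[rule_format] c2[rule_format]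
  define c3 where "c3 t = (if t ^ 3 = -1 then a t else b t)" for t
  have c3: "(\<Sum>t\<in>{t. t ^ 3 = -1} \<union> {t. t ^ 7 = 1}. c3 t * t ^ j) =
      ?A (j mod 3) * (-1) ^ (j div 3) + ?B (j mod 7) * 1 ^ (j div 7)" for j
  proof -
    have "(\<Sum>t | t ^ 7 = 1. c3 t * t ^ j) = (\<Sum>t | t ^ 7 = 1. b t * t ^ j)"
      using cube_septic_roots_disjoint by (intro sum.cong) (auto simp: c3_def)
    moreover have "(\<Sum>t | t ^ 3 = -1. c3 t * t ^ j) = (\<Sum>t | t ^ 3 = -1. a t * t ^ j)"
      by (intro sum.cong) (auto simp: c3_def)
    ultimately show ?thesis
      using cube_septic_roots_disjoint by (subst sum.union_disjoint) (simp_all only: a[rule_format] b[rule_format] finite_nth_roots zero_less_numeral)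
  qed
  show ?thesis
    unfolding nonsection_points_def
  proof (rule ternary_form_in_span_triangle[where n = 2])
    fix j :: nat assume "j \<le> 13"
    then have j: "j \<in> {0,1,2,3,4,5,6,7,8,9,10,11,12,13}" by (rule nat_le_13_cases)
    show "(\<Sum>t | t ^ 10 = 2. c1 t * t ^ j) = of_bool (j = 3) + 2 * of_bool (j = 13)"
      using j unfolding c by (elim insertE emptyE; simp)
    show "(\<Sum>t | t ^ 10 = -1. c2 t * t ^ j) = of_bool (j = 3) - of_bool (j = 13)"
      using j unfolding c by (elim insertE emptyE; simp)
    show "(\<Sum>t\<in>{t. t ^ 3 = -1} \<union> {t. t ^ 7 = 1}. c3 t * t ^ j) =
        of_bool (j = 0) + of_bool (j = 10) + (1 - 2) * of_bool (j = 13)"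
      using j unfolding c3 by (elim insertE emptyE; simp)
  qed (simp_all only: finite_nth_roots finite_Un zero_less_numeral simp_thms)
qed

section \<open>Hilbert functions of finite sets of points\<close>

text \<open>
Elements of \<open>R\<close> dual to the functionals \<open>\<phi> p\<close>, \<open>p \<in> B\<close>, which are then linearly independent on \<open>R\<close>. For
evaluations at points these are forms that separate the points. The rank of a family of functionals is
expressed through such systems, which makes sense in spaces of infinite dimension.
\<close>

definition dual_system :: "'b set \<Rightarrow> ('i \<Rightarrow> 'b \<Rightarrow> 'a::zero_neq_one) \<Rightarrow> 'i set \<Rightarrow> ('i \<Rightarrow> 'b) \<Rightarrow> bool" where
  "dual_system R \<phi> B r \<longleftrightarrow> (\<forall>p\<in>B. r p \<in> R) \<and> (\<forall>p\<in>B. \<forall>q\<in>B. \<phi> q (r p) = of_bool (p = q))"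

context vector_space
begin

text \<open>
The functionals are added one at a time. One that does not vanish on the common kernel of those already
chosen joins the system, and the earlier dual elements are corrected by a multiple of the new one.
Starting from a given system \<open>B0\<close> matters when degrees are compared.
\<close>

lemma dual_system_maximal:
  assumes hom: "\<And>p. module_hom scale (*) (\<phi> p)" and R: "subspace R"
    and C: "finite C" "B0 \<subseteq> C" "dual_system R \<phi> B0 r0"
  shows "\<exists>B r. B0 \<subseteq> B \<and> B \<subseteq> C \<and> dual_system R \<phi> B r \<and>
    (\<forall>g\<in>R. (\<forall>p\<in>B. \<phi> p g = 0) \<longrightarrow> (\<forall>p\<in>C. \<phi> p g = 0))"
proof -
  have "\<exists>B r. B0 \<subseteq> B \<and> B \<subseteq> B0 \<union> D \<and> dual_system R \<phi> B r \<and>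
      (\<forall>g\<in>R. (\<forall>p\<in>B. \<phi> p g = 0) \<longrightarrow> (\<forall>p\<in>B0 \<union> D. \<phi> p g = 0))"
    if "finite D" for D
    using that
  proof (induction D rule: finite_induct)
    case empty
    then show ?case using C(3) by (intro exI[of _ B0] exI[of _ r0]) simp
  next
    case (insert s D)
    then obtain B r where B: "B0 \<subseteq> B" "B \<subseteq> B0 \<union> D" and dual: "dual_system R \<phi> B r"
      and van: "\<And>g p. g \<in> R \<Longrightarrow> \<forall>p\<in>B. \<phi> p g = 0 \<Longrightarrow> p \<in> B0 \<union> D \<Longrightarrow> \<phi> p g = 0"
      by blast
    show ?case
    proof (cases "\<forall>g\<in>R. (\<forall>p\<in>B. \<phi> p g = 0) \<longrightarrow> \<phi> s g = 0")
      case True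
      have "\<forall>g\<in>R. (\<forall>p\<in>B. \<phi> p g = 0) \<longrightarrow> (\<forall>p\<in>B0 \<union> insert s D. \<phi> p g = 0)"
        using True van by blast
      moreover have "B \<subseteq> B0 \<union> insert s D" using B by blast
      ultimately show ?thesis using B(1) dual by blast
    next
      case False
      then obtain g where g: "g \<in> R" "\<And>p. p \<in> B \<Longrightarrow> \<phi> p g = 0" "\<phi> s g \<noteq> 0" by blast
      define e where "e = scale (inverse (\<phi> s g)) g"
      define r' where "r' p = (if p = s then e else r p - scale (\<phi> s (r p)) e)" for p
      have e: "e \<in> R" "\<phi> s e = 1" "\<And>p. p \<in> B \<Longrightarrow> \<phi> p e = 0"
        using g by (auto simp: e_def module_hom.scale[OF hom] intro: subspace_scale[OF R])
      have "s \<notin> B" using g by blast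
      have rR: "r p \<in> R" if "p \<in> B" for p using dual that by (simp add: dual_system_def)
      have rd: "\<phi> q (r p) = of_bool (p = q)" if "p \<in> B" "q \<in> B" for p q
        using dual that by (simp add: dual_system_def)
      have "dual_system R \<phi> (insert s B) r'"
        unfolding dual_system_def
      proof (intro conjI ballI)
        fix p assume "p \<in> insert s B"
        then show "r' p \<in> R"
          using e rR by (auto simp: r'_def intro!: subspace_diff[OF R] subspace_scale[OF R])
        fix q assume "q \<in> insert s B"
        then show "\<phi> q (r' p) = of_bool (p = q)"
          using \<open>p \<in> insert s B\<close> \<open>s \<notin> B\<close> e rd
          by (auto simp: r'_def module_hom.diff[OF hom] module_hom.scale[OF hom])
      qed
      moreover have "\<forall>g\<in>R. (\<forall>p\<in>insert s B. \<phi> p g = 0) \<longrightarrow> (\<forall>p\<in>B0 \<union> insert s D. \<phi> p g = 0)"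
        using van by blast
      moreover have "B0 \<subseteq> insert s B" "insert s B \<subseteq> B0 \<union> insert s D" using B by blast+
      ultimately show ?thesis by blast
    qed
  qed
  from this[OF C(1)] show ?thesis using C(2) by (simp add: Un_absorb1)
qed

text \<open>
A basis of the common kernel together with the dual elements is a basis of \<open>R\<close>.
\<close>

lemma dim_eq_dim_kernel_plus_card:
  assumes hom: "\<And>p. module_hom scale (*) (\<phi> p)" and R: "subspace R"
    and fin: "finite F" "R \<subseteq> span F" and B: "finite B" and dual: "dual_system R \<phi> B r"
  shows "dim R = dim {g \<in> R. \<forall>p\<in>B. \<phi> p g = 0} + card B"
proof -
  let ?K = "{g \<in> R. \<forall>p\<in>B. \<phi> p g = 0}"
  have rR: "r p \<in> R" if "p \<in> B" for p using dual that by (simp add: dual_system_def)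
  have rd: "\<phi> q (r p) = of_bool (p = q)" if "p \<in> B" "q \<in> B" for p q
    using dual that by (simp add: dual_system_def)
  obtain b where b: "b \<subseteq> ?K" "independent b" "?K \<subseteq> span b" "card b = dim ?K"
    by (rule basis_exists)
  have "b \<subseteq> span F" using b(1) fin(2) by blast
  then have finb: "finite b" using independent_span_bound[OF fin(1) b(2)] by blast
  have inj: "inj_on r B"
  proof (rule inj_onI)
    fix p q assume pq: "p \<in> B" "q \<in> B" "r p = r q"
    then have "of_bool (p = q) = (1 :: 'a)" using rd[of p q] rd[of q q] by simp
    then show "p = q" by (simp split: if_splits)
  qed
  have disj: "b \<inter> r ` B = {}"
  proof -
    have False if "p \<in> B" "r p \<in> b" for p
      using b(1) that rd[of p p] by auto
    then show ?thesis by blast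
  qed
  have phisum: "\<phi> q (\<Sum>p\<in>B. scale (u p) (r p)) = u q" if "q \<in> B" for q u
  proof -
    have "\<phi> q (\<Sum>p\<in>B. scale (u p) (r p)) = (\<Sum>p\<in>B. if p = q then u p else 0)"
      unfolding module_hom.sum[OF hom] module_hom.scale[OF hom]
      by (rule sum.cong) (use rd that in auto)
    then show ?thesis using that B by simp
  qed
  have ind: "independent (b \<union> r ` B)"
  proof (rule independent_if_scalars_zero)
    show "finite (b \<union> r ` B)" using finb B by simp
    fix f x assume sum0: "(\<Sum>x\<in>b \<union> r ` B. scale (f x) x) = 0" and x: "x \<in> b \<union> r ` B"
    have eq: "(\<Sum>x\<in>b. scale (f x) x) + (\<Sum>p\<in>B. scale (f (r p)) (r p)) = 0"
      using sum0 finb B disj inj by (simp add: sum.union_disjoint sum.reindex)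
    have fr: "f (r q) = 0" if "q \<in> B" for q
    proof -
      have "\<phi> q (\<Sum>x\<in>b. scale (f x) x) = 0"
        unfolding module_hom.sum[OF hom] module_hom.scale[OF hom]
        by (rule sum.neutral) (use b(1) that in auto)
      moreover have "\<phi> q ((\<Sum>x\<in>b. scale (f x) x) + (\<Sum>p\<in>B. scale (f (r p)) (r p))) = 0"
        unfolding eq by (rule module_hom.zero[OF hom])
      ultimately show ?thesis
        unfolding module_hom.add[OF hom] using phisum[OF that] by simp
    qed
    then have "(\<Sum>x\<in>b. scale (f x) x) = 0" using eq by simp
    then show "f x = 0"
      using independentD[OF b(2) finb order_refl] fr x by auto
  qed
  have span: "R \<subseteq> span (b \<union> r ` B)"
  proof
    fix g assume g: "g \<in> R"
    define h where "h = (\<Sum>p\<in>B. scale (\<phi> p g) (r p))"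
    have "h \<in> R" unfolding h_def
      by (intro subspace_sum[OF R] subspace_scale[OF R] rR)
    then have "g - h \<in> ?K"
      using g phisum by (auto simp: h_def module_hom.diff[OF hom] intro: subspace_diff[OF R])
    then have "g - h \<in> span (b \<union> r ` B)"
      using b(3) span_mono[of b "b \<union> r ` B"] by blast
    moreover have "h \<in> span (b \<union> r ` B)"
      unfolding h_def by (intro span_sum span_scale span_base) simp
    ultimately have "(g - h) + h \<in> span (b \<union> r ` B)" by (rule span_add)
    then show "g \<in> span (b \<union> r ` B)" by simp
  qed
  have "b \<union> r ` B \<subseteq> R" using b(1) rR by blast
  then have "card (b \<union> r ` B) = dim R"
    using span ind by (rule basis_card_eq_dim)
  moreover have "card (b \<union> r ` B) = card b + card B"
    using finb B disj inj by (simp add: card_Un_disjoint card_image)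
  ultimately show ?thesis using b(4) by simp
qed

end

lemma eval3_superset:
  assumes "finite S" "Poly_Mapping.keys g \<subseteq> S"
  shows "eval3 g a = (\<Sum>m\<in>S. Poly_Mapping.lookup g m * (\<Prod>i\<in>UNIV. a i ^ Poly_Mapping.lookup m i))"
  unfolding eval3_def using assms by (intro sum.mono_neutral_left) (auto simp: in_keys_iff)

lemma eval3_add: "eval3 (p + q) a = eval3 p a + eval3 q a"
proof -
  let ?S = "Poly_Mapping.keys p \<union> Poly_Mapping.keys q"
  have "Poly_Mapping.keys (p + q) \<subseteq> ?S" by (rule keys_add)
  then show ?thesis
    by (subst (1 2 3) eval3_superset[where S = ?S]) (simp_all add: lookup_add distrib_right sum.distrib)
qed

lemma eval3_cscale: "eval3 (cscale c p) a = c * eval3 p a"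
proof -
  have "Poly_Mapping.keys (cscale c p) \<subseteq> Poly_Mapping.keys p" by (auto simp: in_keys_iff)
  then show ?thesis
    by (subst (1 2) eval3_superset[where S = "Poly_Mapping.keys p"])
      (simp_all add: sum_distrib_left mult.assoc)
qed

lemma eval3_hom: "module_hom cscale (*) (\<lambda>g. eval3 g a)"
  by unfold_locales (simp_all add: eval3_add eval3_cscale distrib_left distrib_right)

lemmas eval3_sum = module_hom.sum[OF eval3_hom]

lemma eval3_mterm: "eval3 (mterm m c) a = c * (\<Prod>i\<in>UNIV. a i ^ Poly_Mapping.lookup m i)"
  by (simp add: eval3_superset[of "{m}"])

lemma eval3_mterm_mon: "eval3 (mterm (mon i j k) c) a = c * (a 0 ^ i * a 1 ^ j * a 2 ^ k)"
  by (simp add: eval3_mterm prod_3)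

lemma eval3_mult: "eval3 (p * q) a = eval3 p a * eval3 q a"
proof -
  have mm: "eval3 (mterm m c * mterm m' c') a = eval3 (mterm m c) a * eval3 (mterm m' c') a" for m m' c c'
    by (simp add: mult_single eval3_mterm lookup_add power_add prod.distrib)
  have "p * q = (\<Sum>m\<in>Poly_Mapping.keys p. \<Sum>m'\<in>Poly_Mapping.keys q.
      mterm m (Poly_Mapping.lookup p m) * mterm m' (Poly_Mapping.lookup q m'))"
    by (subst poly_eq_sum_mterm[of p], subst poly_eq_sum_mterm[of q]) (rule sum_product)
  then have "eval3 (p * q) a = (\<Sum>m\<in>Poly_Mapping.keys p. \<Sum>m'\<in>Poly_Mapping.keys q.
      eval3 (mterm m (Poly_Mapping.lookup p m)) a * eval3 (mterm m' (Poly_Mapping.lookup q m')) a)"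
    by (simp only: eval3_sum mm)
  also have "\<dots> = (\<Sum>m\<in>Poly_Mapping.keys p. eval3 (mterm m (Poly_Mapping.lookup p m)) a) *
      (\<Sum>m'\<in>Poly_Mapping.keys q. eval3 (mterm m' (Poly_Mapping.lookup q m')) a)"
    by (rule sum_product[symmetric])
  also have "\<dots> = eval3 p a * eval3 q a"
    by (simp only: eval3_sum[symmetric] poly_eq_sum_mterm[symmetric])
  finally show ?thesis .
qed

lemma eval3_homogeneous:
  assumes "g \<in> graded_piece (int n)"
  shows "eval3 g (\<lambda>i. k * a i) = k ^ n * eval3 g a"
  unfolding eval3_def sum_distrib_left
proof (rule sum.cong)
  fix m assume "m \<in> Poly_Mapping.keys g"
  then have "mdegree m = n" using assms by (auto simp: graded_piece_def)
  then have "(\<Prod>i\<in>UNIV. k ^ Poly_Mapping.lookup m i) = k ^ n"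
    by (simp add: mdegree_def power_sum[symmetric])
  then show "Poly_Mapping.lookup g m * (\<Prod>i\<in>UNIV. (k * a i) ^ Poly_Mapping.lookup m i) =
      k ^ n * (Poly_Mapping.lookup g m * (\<Prod>i\<in>UNIV. a i ^ Poly_Mapping.lookup m i))"
    by (simp add: power_mult_distrib prod.distrib)
qed simp

lemma finite_monomials: "finite {m :: monom3. mdegree m = n}"
proof (rule finite_subset)
  show "{m. mdegree m = n} \<subseteq> (\<lambda>(i, j, k). mon i j k) ` ({..n} \<times> {..n} \<times> {..n})"
  proof
    fix m assume m: "m \<in> {m. mdegree m = n}"
    obtain i j k where "m = mon i j k" by (rule mon_cases)
    then show "m \<in> (\<lambda>(i, j, k). mon i j k) ` ({..n} \<times> {..n} \<times> {..n})"
      using m by (intro image_eqI[of _ _ "(i, j, k)"]) auto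
  qed
qed simp

lemma graded_piece_subset_span:
  "graded_piece (int n) \<subseteq> cvs.span ((\<lambda>m. mterm m 1) ` {m. mdegree m = n})"
proof
  fix g assume g: "g \<in> graded_piece (int n)"
  have "(\<Sum>m\<in>Poly_Mapping.keys g. cscale (Poly_Mapping.lookup g m) (mterm m 1)) \<in>
      cvs.span ((\<lambda>m. mterm m 1) ` {m. mdegree m = n})"
    using g by (intro cvs.span_sum cvs.span_scale cvs.span_base) (auto simp: graded_piece_def)
  also have "(\<Sum>m\<in>Poly_Mapping.keys g. cscale (Poly_Mapping.lookup g m) (mterm m 1)) = g"
    by (simp add: cscale_mterm poly_eq_sum_mterm[symmetric])
  finally show "g \<in> cvs.span ((\<lambda>m. mterm m 1) ` {m. mdegree m = n})" .
qed

lemma coords_cscale: "coords (cscale k l) i = k * coords l i"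
  by (simp add: coords_def)

text \<open>
For homogeneous polynomials, vanishing at one representative of a point implies vanishing at all.
\<close>

lemma vanishing_ideal_graded:
  assumes "0 \<notin> B"
  shows "vanishing_ideal (proj_point ` B) \<inter> graded_piece (int n) =
    {g \<in> graded_piece (int n). \<forall>l\<in>B. eval3 g (coords l) = 0}"
proof (intro equalityI subsetI)
  fix g assume "g \<in> vanishing_ideal (proj_point ` B) \<inter> graded_piece (int n)"
  moreover have "l \<in> proj_point l - {0}" if "l \<in> B" for l
    using that assms by (auto simp: proj_point_def cvs.span_base)
  ultimately show "g \<in> {g \<in> graded_piece (int n). \<forall>l\<in>B. eval3 g (coords l) = 0}"
    by (auto simp: vanishing_ideal_def)
next
  fix g assume g: "g \<in> {g \<in> graded_piece (int n). \<forall>l\<in>B. eval3 g (coords l) = 0}"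
  have "eval3 g (coords l') = 0" if l: "l \<in> B" "l' \<in> proj_point l" for l l'
  proof -
    obtain k where "l' = cscale k l"
      using l(2) by (auto simp: proj_point_def cvs.span_singleton)
    then have "coords l' = (\<lambda>i. k * coords l i)" by (simp add: fun_eq_iff coords_cscale)
    then show ?thesis using eval3_homogeneous[of g n k "coords l"] g l by simp
  qed
  then show "g \<in> vanishing_ideal (proj_point ` B) \<inter> graded_piece (int n)"
    using g by (auto simp: vanishing_ideal_def)
qed

abbreviation dual_forms :: "nat \<Rightarrow> poly3 set \<Rightarrow> (poly3 \<Rightarrow> poly3) \<Rightarrow> bool" where
  "dual_forms n \<equiv> dual_system (graded_piece (int n)) (\<lambda>l g. eval3 g (coords l))"

text \<open>
The Hilbert function counts the points of any subset that is separated by forms of degree \<open>n\<close> and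
maximal in the sense that forms vanishing on it vanish on the whole set.
\<close>

lemma hilbert_function_eq_card_dual:
  assumes "finite B" "0 \<notin> B" "B' \<subseteq> B" "dual_forms n B' r"
    and van: "\<And>g l. g \<in> graded_piece (int n) \<Longrightarrow> \<forall>p\<in>B'. eval3 g (coords p) = 0 \<Longrightarrow> l \<in> B \<Longrightarrow>
      eval3 g (coords l) = 0"
  shows "hilbert_function (proj_point ` B) (int n) = int (card B')"
proof -
  have "vanishing_ideal (proj_point ` B) \<inter> graded_piece (int n) =
      {g \<in> graded_piece (int n). \<forall>l\<in>B'. eval3 g (coords l) = 0}"
    unfolding vanishing_ideal_graded[OF assms(2)] using van assms(3) by blast
  moreover have "cvs.dim (graded_piece (int n)) =
      cvs.dim {g \<in> graded_piece (int n). \<forall>l\<in>B'. eval3 g (coords l) = 0} + card B'"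
    by (rule cvs.dim_eq_dim_kernel_plus_card[OF eval3_hom graded_piece_subspace _
          graded_piece_subset_span _ assms(4)])
      (use assms finite_monomials finite_subset in auto)
  ultimately show ?thesis by (simp add: hilbert_function_def)
qed

lemma obtain_dual_forms:
  assumes "finite B" "0 \<notin> B" "B0 \<subseteq> B" "dual_forms n B0 r0"
  obtains B' r where "B0 \<subseteq> B'" "B' \<subseteq> B" "dual_forms n B' r"
    "\<And>g l. g \<in> graded_piece (int n) \<Longrightarrow> \<forall>p\<in>B'. eval3 g (coords p) = 0 \<Longrightarrow> l \<in> B \<Longrightarrow>
      eval3 g (coords l) = 0"
    "hilbert_function (proj_point ` B) (int n) = int (card B')"
proof -
  have "\<exists>B' r. B0 \<subseteq> B' \<and> B' \<subseteq> B \<and> dual_forms n B' r \<and>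
      (\<forall>g\<in>graded_piece (int n). (\<forall>p\<in>B'. eval3 g (coords p) = 0) \<longrightarrow> (\<forall>p\<in>B. eval3 g (coords p) = 0))"
    by (rule cvs.dual_system_maximal[OF eval3_hom graded_piece_subspace assms(1,3,4)])
  then obtain B' r where *: "B0 \<subseteq> B'" "B' \<subseteq> B" "dual_forms n B' r"
    and van: "\<forall>g\<in>graded_piece (int n). (\<forall>p\<in>B'. eval3 g (coords p) = 0) \<longrightarrow>
      (\<forall>p\<in>B. eval3 g (coords p) = 0)" by blast
  have van': "eval3 g (coords l) = 0"
    if "g \<in> graded_piece (int n)" "\<forall>p\<in>B'. eval3 g (coords p) = 0" "l \<in> B" for g l
    using van that by blast
  show thesis
    by (rule that[OF * van' hilbert_function_eq_card_dual[OF assms(1,2) *(2,3) van']])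
qed

definition point_relation :: "nat \<Rightarrow> poly3 set \<Rightarrow> (poly3 \<Rightarrow> complex) \<Rightarrow> bool" where
  "point_relation n B c \<longleftrightarrow> (\<forall>g\<in>graded_piece (int n). (\<Sum>l\<in>B. c l * eval3 g (coords l)) = 0)"

lemma dual_forms_interpolation:
  assumes "finite B'" "dual_forms n B' r"
    and van: "\<And>g l. g \<in> graded_piece (int n) \<Longrightarrow> \<forall>p\<in>B'. eval3 g (coords p) = 0 \<Longrightarrow> l \<in> B \<Longrightarrow>
      eval3 g (coords l) = 0"
    and g: "g \<in> graded_piece (int n)" and s: "s \<in> B"
  shows "eval3 g (coords s) = (\<Sum>p\<in>B'. eval3 g (coords p) * eval3 (r p) (coords s))"
proof -
  have r: "r p \<in> graded_piece (int n)" if "p \<in> B'" for p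
    using assms(2) that by (simp add: dual_system_def)
  have rd: "eval3 (r p) (coords q) = of_bool (p = q)" if "p \<in> B'" "q \<in> B'" for p q
    using assms(2) that by (simp add: dual_system_def)
  define h where "h = g - (\<Sum>p\<in>B'. cscale (eval3 g (coords p)) (r p))"
  have ev: "eval3 h a = eval3 g a - (\<Sum>p\<in>B'. eval3 g (coords p) * eval3 (r p) a)" for a
    by (simp add: h_def module_hom.diff[OF eval3_hom] eval3_sum eval3_cscale)
  have "h \<in> graded_piece (int n)"
    unfolding h_def
    by (intro cvs.subspace_diff[OF graded_piece_subspace] cvs.subspace_sum[OF graded_piece_subspace]
        cvs.subspace_scale[OF graded_piece_subspace] r g)
  moreover have "eval3 h (coords q) = 0" if "q \<in> B'" for q
  proof -
    have "(\<Sum>p\<in>B'. eval3 g (coords p) * eval3 (r p) (coords q)) =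
        (\<Sum>p\<in>B'. if p = q then eval3 g (coords p) else 0)"
      by (rule sum.cong) (use rd that in auto)
    then show ?thesis using that assms(1) by (simp add: ev)
  qed
  ultimately have "eval3 h (coords s) = 0" using van s by blast
  then show ?thesis by (simp add: ev)
qed

text \<open>
If a point \<open>s\<close> were missing from a maximal separated subset, then interpolation of the values at \<open>s\<close> by
those on the subset would be a nontrivial relation.
\<close>

lemma hilbert_function_eq_card:
  assumes B: "finite B" "0 \<notin> B"
    and triv: "\<And>c l. point_relation n B c \<Longrightarrow> l \<in> B \<Longrightarrow> c l = 0"
  shows "hilbert_function (proj_point ` B) (int n) = int (card B)"
proof -
  have "dual_forms n {} undefined" by (simp add: dual_system_def)
  then obtain B' r where B': "B' \<subseteq> B" "dual_forms n B' r"
    and van: "\<And>g l. g \<in> graded_piece (int n) \<Longrightarrow> \<forall>p\<in>B'. eval3 g (coords p) = 0 \<Longrightarrow> l \<in> B \<Longrightarrow>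
      eval3 g (coords l) = 0"
    and h: "hilbert_function (proj_point ` B) (int n) = int (card B')"
    using obtain_dual_forms[OF B empty_subsetI] by metis
  have finB': "finite B'" using B B' finite_subset by blast
  have "s \<in> B'" if s: "s \<in> B" for s
  proof (rule ccontr)
    assume ns: "s \<notin> B'"
    define c where "c p = (if p = s then 1 else if p \<in> B' then - eval3 (r p) (coords s) else 0)" for p
    have "point_relation n B c"
      unfolding point_relation_def
    proof
      fix g assume g: "g \<in> graded_piece (int n)"
      have "(\<Sum>l\<in>B. c l * eval3 g (coords l)) = (\<Sum>l\<in>insert s B'. c l * eval3 g (coords l))"
        using B B' s by (intro sum.mono_neutral_right) (auto simp: c_def)
      also have "\<dots> = eval3 g (coords s) + (\<Sum>l\<in>B'. c l * eval3 g (coords l))"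
        using ns finB' by (simp add: c_def)
      also have "(\<Sum>l\<in>B'. c l * eval3 g (coords l)) =
          (\<Sum>l\<in>B'. - (eval3 g (coords l) * eval3 (r l) (coords s)))"
        using ns by (intro sum.cong) (auto simp: c_def)
      also have "\<dots> = - eval3 g (coords s)"
        by (simp add: sum_negf dual_forms_interpolation[OF finB' B'(2) van g s, symmetric])
      finally show "(\<Sum>l\<in>B. c l * eval3 g (coords l)) = 0" by simp
    qed
    then have "c s = 0" using triv s by blast
    then show False by (simp add: c_def)
  qed
  then have "B' = B" using B' by blast
  then show ?thesis using h by simp
qed

lemma hilbert_function_less_card:
  assumes B: "finite B" "0 \<notin> B" and rel: "point_relation n B c" and l0: "l0 \<in> B" "c l0 \<noteq> 0"
  shows "hilbert_function (proj_point ` B) (int n) < int (card B)"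
proof -
  have "dual_forms n {} undefined" by (simp add: dual_system_def)
  then obtain B' r where B': "B' \<subseteq> B" "dual_forms n B' r"
    and h: "hilbert_function (proj_point ` B) (int n) = int (card B')"
    using obtain_dual_forms[OF B empty_subsetI] by metis
  have "B' \<noteq> B"
  proof
    assume eq: "B' = B"
    have "r l0 \<in> graded_piece (int n)" using B'(2) l0 eq by (simp add: dual_system_def)
    then have "(\<Sum>l\<in>B. c l * eval3 (r l0) (coords l)) = 0" using rel by (simp add: point_relation_def)
    also have "(\<Sum>l\<in>B. c l * eval3 (r l0) (coords l)) = (\<Sum>l\<in>B. if l = l0 then c l else 0)"
      using B'(2) l0 eq by (intro sum.cong) (auto simp: dual_system_def)
    also have "\<dots> = c l0" using B l0 by simp
    finally show False using l0 by simp
  qed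
  then show ?thesis using h B' B psubset_card_mono[of B B'] by auto
qed

lemma point_relation_monomials:
  "point_relation n B c \<longleftrightarrow> (\<forall>i j k. i + j + k = n \<longrightarrow>
    (\<Sum>l\<in>B. c l * (coords l 0 ^ i * coords l 1 ^ j * coords l 2 ^ k)) = 0)" (is "_ \<longleftrightarrow> ?M")
proof
  assume rel: "point_relation n B c"
  show ?M
  proof (intro allI impI)
    fix i j k assume "i + j + k = n"
    then have "mterm (mon i j k) 1 \<in> graded_piece (int n)" by (intro mterm_in_graded_piece) simp
    then have "(\<Sum>l\<in>B. c l * eval3 (mterm (mon i j k) 1) (coords l)) = 0"
      using rel by (simp only: point_relation_def)
    then show "(\<Sum>l\<in>B. c l * (coords l 0 ^ i * coords l 1 ^ j * coords l 2 ^ k)) = 0"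
      by (simp add: eval3_mterm_mon)
  qed
next
  assume M: ?M
  show "point_relation n B c"
    unfolding point_relation_def
  proof
    fix g assume g: "g \<in> graded_piece (int n)"
    have mono0: "(\<Sum>l\<in>B. c l * (\<Prod>i\<in>UNIV. coords l i ^ Poly_Mapping.lookup m i)) = 0"
      if "m \<in> Poly_Mapping.keys g" for m
    proof -
      obtain i j k where m: "m = mon i j k" by (rule mon_cases)
      have "i + j + k = n" using g that by (auto simp: graded_piece_def m)
      then show ?thesis using M by (simp add: m prod_3)
    qed
    have "(\<Sum>l\<in>B. c l * eval3 g (coords l)) = (\<Sum>m\<in>Poly_Mapping.keys g. Poly_Mapping.lookup g m *
        (\<Sum>l\<in>B. c l * (\<Prod>i\<in>UNIV. coords l i ^ Poly_Mapping.lookup m i)))"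
      unfolding eval3_def sum_distrib_left by (subst sum.swap) (simp only: mult_ac)
    also have "\<dots> = 0" by (rule sum.neutral) (simp add: mono0)
    finally show "(\<Sum>l\<in>B. c l * eval3 g (coords l)) = 0" .
  qed
qed

section \<open>Regularities of the two sets\<close>

lemma graded_piece_Suc_monomial:
  assumes "mdegree m = Suc n"
  obtains x m' where "x \<in> graded_piece 1" "mdegree m' = n" "mterm m c = x * mterm m' c"
proof -
  obtain i j k where m: "m = mon i j k" by (rule mon_cases)
  have "i + j + k = Suc n" using assms by (simp add: m)
  then consider i' where "i = Suc i'" | j' where "j = Suc j'" | k' where "k = Suc k'"
    by (cases i; cases j; cases k) auto
  then show thesis
  proof cases
    case 1
    show thesis
    proof (rule that)
      show "mterm (mon 1 0 0) 1 \<in> graded_piece 1" by (rule mterm_in_graded_piece) simp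
      show "mdegree (mon i' j k) = n" using assms by (simp add: m 1)
      show "mterm m c = mterm (mon 1 0 0) 1 * mterm (mon i' j k) c"
        by (simp add: m 1 mult_single mon_add)
    qed
  next
    case 2
    show thesis
    proof (rule that)
      show "mterm (mon 0 1 0) 1 \<in> graded_piece 1" by (rule mterm_in_graded_piece) simp
      show "mdegree (mon i j' k) = n" using assms by (simp add: m 2)
      show "mterm m c = mterm (mon 0 1 0) 1 * mterm (mon i j' k) c"
        by (simp add: m 2 mult_single mon_add)
    qed
  next
    case 3
    show thesis
    proof (rule that)
      show "mterm (mon 0 0 1) 1 \<in> graded_piece 1" by (rule mterm_in_graded_piece) simp
      show "mdegree (mon i j k') = n" using assms by (simp add: m 3)
      show "mterm m c = mterm (mon 0 0 1) 1 * mterm (mon i j k') c"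
        by (simp add: m 3 mult_single mon_add)
    qed
  qed
qed

text \<open>
A linear form that misses the points carries separating forms to the next degree.
\<close>

lemma dual_forms_mult:
  assumes dual: "dual_forms n B' r" and L: "L \<in> graded_piece 1"
    and nz: "\<And>l. l \<in> B' \<Longrightarrow> eval3 L (coords l) \<noteq> 0"
  shows "dual_forms (Suc n) B' (\<lambda>p. cscale (inverse (eval3 L (coords p))) (L * r p))"
  unfolding dual_system_def
proof (intro conjI ballI)
  fix p assume p: "p \<in> B'"
  have "r p \<in> graded_piece (int n)" using dual p by (simp add: dual_system_def)
  then have "L * r p \<in> graded_piece (1 + int n)" by (rule graded_piece_mult[OF L])
  moreover have "1 + int n = int (Suc n)" by simp
  ultimately show "cscale (inverse (eval3 L (coords p))) (L * r p) \<in> graded_piece (int (Suc n))"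
    by (simp only: cvs.subspace_scale[OF graded_piece_subspace])
  fix q assume q: "q \<in> B'"
  have "eval3 (r p) (coords q) = of_bool (p = q)" using dual p q by (simp add: dual_system_def)
  then show "eval3 (cscale (inverse (eval3 L (coords p))) (L * r p)) (coords q) = of_bool (p = q)"
    using nz[OF p] by (cases "p = q") (simp_all add: eval3_cscale eval3_mult)
qed

text \<open>
Let \<open>B'\<close> be a maximal separated subset in degree \<open>n\<close>. Multiplication by \<open>L\<close> keeps it separated, and by
equality of the two values it is still maximal in degree \<open>n + 1\<close>. Thus every form of degree \<open>n + 1\<close> is
interpolated from its values on \<open>B'\<close>. For a product \<open>x q\<close> with a linear form \<open>x\<close> one interpolates first \<open>q\<close>
and then the products \<open>x r\<^sub>p\<close>, which gives interpolation in degree \<open>n + 2\<close>, as such products span all forms of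
that degree. Hence \<open>B'\<close> remains maximal.
\<close>

lemma hilbert_function_stable_Suc:
  assumes B: "finite B" "0 \<notin> B" and L: "L \<in> graded_piece 1"
    and nz: "\<And>l. l \<in> B \<Longrightarrow> eval3 L (coords l) \<noteq> 0"
    and eq: "hilbert_function (proj_point ` B) (int n) = hilbert_function (proj_point ` B) (int (Suc n))"
  shows "hilbert_function (proj_point ` B) (int (Suc (Suc n))) =
    hilbert_function (proj_point ` B) (int (Suc n))"
proof -
  have "dual_forms n {} undefined" by (simp add: dual_system_def)
  then obtain B' r where B': "B' \<subseteq> B" and dual: "dual_forms n B' r"
    and h: "hilbert_function (proj_point ` B) (int n) = int (card B')"
    using obtain_dual_forms[OF B empty_subsetI] by metis
  have nz': "eval3 L (coords l) \<noteq> 0" if "l \<in> B'" for l using nz B' that by blast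
  have finB': "finite B'" using B B' finite_subset by blast
  define w where "w p = inverse (eval3 L (coords p))" for p
  define e where "e p = cscale (w p) (L * r p)" for p
  define e2 where "e2 p = cscale (w p) (L * e p)" for p
  have dual1: "dual_forms (Suc n) B' e"
    unfolding e_def w_def by (rule dual_forms_mult[OF dual L nz'])
  have dual2: "dual_forms (Suc (Suc n)) B' e2"
    unfolding e2_def w_def by (rule dual_forms_mult[OF dual1 L nz'])
  have van: "eval3 g (coords l) = 0"
    if g: "g \<in> graded_piece (int (Suc n))" "\<forall>p\<in>B'. eval3 g (coords p) = 0" "l \<in> B" for g l
  proof -
    obtain B'' where B'': "B' \<subseteq> B''" "B'' \<subseteq> B"
      and van'': "\<And>g l. g \<in> graded_piece (int (Suc n)) \<Longrightarrow> \<forall>p\<in>B''. eval3 g (coords p) = 0 \<Longrightarrow>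
        l \<in> B \<Longrightarrow> eval3 g (coords l) = 0"
      and h'': "hilbert_function (proj_point ` B) (int (Suc n)) = int (card B'')"
      by (rule obtain_dual_forms[OF B B' dual1]) (rule that)
    have "finite B''" using B B'' finite_subset by blast
    moreover have "card B' = card B''" using h h'' eq by simp
    ultimately have "B' = B''" using B''(1) by (intro card_subset_eq)
    then show ?thesis using van'' g by blast
  qed
  have interp: "eval3 g (coords s) = (\<Sum>p\<in>B'. eval3 g (coords p) * eval3 (e p) (coords s))"
    if "g \<in> graded_piece (int (Suc n))" "s \<in> B" for g s
    by (rule dual_forms_interpolation[OF finB' dual1 van that])
  have mult: "eval3 (x * q) (coords s) = (\<Sum>p\<in>B'. eval3 (x * q) (coords p) * eval3 (e2 p) (coords s))"
    if x: "x \<in> graded_piece 1" and q: "q \<in> graded_piece (int (Suc n))" and s: "s \<in> B" for x q s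
  proof -
    have xr: "eval3 x (coords s) * eval3 (r p) (coords s) = eval3 x (coords p) * eval3 (e p) (coords s)"
      if p: "p \<in> B'" for p
    proof -
      have "r p \<in> graded_piece (int n)" using dual p by (simp add: dual_system_def)
      then have "x * r p \<in> graded_piece (1 + int n)" by (rule graded_piece_mult[OF x])
      moreover have "1 + int n = int (Suc n)" by simp
      ultimately have "x * r p \<in> graded_piece (int (Suc n))" by (simp only:)
      from interp[OF this s] have "eval3 x (coords s) * eval3 (r p) (coords s) =
          (\<Sum>p'\<in>B'. eval3 (x * r p) (coords p') * eval3 (e p') (coords s))"
        by (simp add: eval3_mult)
      also have "\<dots> = (\<Sum>p'\<in>B'. if p' = p then eval3 x (coords p) * eval3 (e p) (coords s) else 0)"
        using dual p by (intro sum.cong) (auto simp: dual_system_def eval3_mult)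
      finally show ?thesis using p finB' by simp
    qed
    have "eval3 (x * q) (coords s) =
        eval3 x (coords s) * (\<Sum>p\<in>B'. eval3 q (coords p) * eval3 (e p) (coords s))"
      by (simp only: eval3_mult interp[OF q s])
    also have "\<dots> = (\<Sum>p\<in>B'. eval3 q (coords p) * w p * eval3 L (coords s) *
        (eval3 x (coords s) * eval3 (r p) (coords s)))"
      unfolding sum_distrib_left
      by (rule sum.cong) (simp_all add: e_def eval3_cscale eval3_mult)
    also have "\<dots> = (\<Sum>p\<in>B'. eval3 (x * q) (coords p) * eval3 (e2 p) (coords s))"
      by (rule sum.cong) (simp_all add: xr e2_def eval3_cscale eval3_mult)
    finally show ?thesis .
  qed
  have van2: "eval3 g (coords s) = 0"
    if g: "g \<in> graded_piece (int (Suc (Suc n)))" and 0: "\<forall>p\<in>B'. eval3 g (coords p) = 0"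
      and s: "s \<in> B" for g s
  proof -
    let ?t = "\<lambda>m. mterm m (Poly_Mapping.lookup g m)"
    have key: "eval3 (?t m) (coords s) = (\<Sum>p\<in>B'. eval3 (?t m) (coords p) * eval3 (e2 p) (coords s))"
      if "m \<in> Poly_Mapping.keys g" for m
    proof -
      have "mdegree m = Suc (Suc n)" using g that by (auto simp: graded_piece_def)
      then obtain x m' where x: "x \<in> graded_piece 1" "mdegree m' = Suc n"
        "?t m = x * mterm m' (Poly_Mapping.lookup g m)"
        by (rule graded_piece_Suc_monomial)
      have "mterm m' (Poly_Mapping.lookup g m) \<in> graded_piece (int (Suc n))"
        using x(2) by (intro mterm_in_graded_piece) simp
      then show ?thesis unfolding x(3) by (rule mult[OF x(1) _ s])
    qed
    have "eval3 g a = (\<Sum>m\<in>Poly_Mapping.keys g. eval3 (?t m) a)" for a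
      by (simp only: eval3_sum[symmetric] poly_eq_sum_mterm[symmetric])
    note expand = this
    have "eval3 g (coords s) = (\<Sum>m\<in>Poly_Mapping.keys g.
        \<Sum>p\<in>B'. eval3 (?t m) (coords p) * eval3 (e2 p) (coords s))"
      unfolding expand[of "coords s"] by (rule sum.cong) (simp_all add: key)
    also have "\<dots> = (\<Sum>p\<in>B'. eval3 g (coords p) * eval3 (e2 p) (coords s))"
      unfolding expand sum_distrib_right by (rule sum.swap)
    also have "\<dots> = 0" using 0 by simp
    finally show ?thesis .
  qed
  have "hilbert_function (proj_point ` B) (int (Suc (Suc n))) = int (card B')"
    by (rule hilbert_function_eq_card_dual[OF B B' dual2 van2])
  then show ?thesis using h eq by simp
qed

lemma hilbert_function_stable:
  assumes B: "finite B" "0 \<notin> B" and L: "L \<in> graded_piece 1"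
    and nz: "\<And>l. l \<in> B \<Longrightarrow> eval3 L (coords l) \<noteq> 0"
    and eq: "hilbert_function (proj_point ` B) (int n) = hilbert_function (proj_point ` B) (int n + 1)"
    and "n \<le> m"
  shows "hilbert_function (proj_point ` B) (int m) = hilbert_function (proj_point ` B) (int n)"
proof -
  let ?h = "\<lambda>k. hilbert_function (proj_point ` B) (int k)"
  have "?h (n + k) = ?h n \<and> ?h (Suc (n + k)) = ?h n" for k
  proof (induction k)
    case 0
    then show ?case using eq by (simp add: add.commute)
  next
    case (Suc k)
    then show ?case using hilbert_function_stable_Suc[OF B L nz, of "n + k"] by simp
  qed
  then show ?thesis using assms(6) le_Suc_ex by blast
qed

lemma point_relation_triangle_points:
  assumes "finite T1" "finite T2" "finite T3" "0 \<notin> T1" "0 \<notin> T2"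
  shows "point_relation n (triangle_points T1 T2 T3) c \<longleftrightarrow> (\<forall>i j k. i + j + k = n \<longrightarrow>
    (\<Sum>t\<in>T1. c (lin 1 t 0) * t ^ j) * 0 ^ k + (\<Sum>t\<in>T2. c (lin 1 0 t) * t ^ k) * 0 ^ j +
    (\<Sum>t\<in>T3. c (lin 0 t 1) * t ^ j) * 0 ^ i = 0)"
  unfolding point_relation_monomials sum_triangle_points[OF assms]
  by (simp add: sum_distrib_left sum_distrib_right mult_ac)

lemma zero_of_moments_1_to_10:
  fixes T :: "complex set"
  assumes "card T = 10" "0 \<notin> T" "\<And>j. 1 \<le> j \<Longrightarrow> j \<le> 10 \<Longrightarrow> (\<Sum>t\<in>T. c t * t ^ j) = 0" "t \<in> T"
  shows "c t = 0"
proof -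
  have "finite T" using assms(1) by (intro card_ge_0_finite) simp
  then have "c t * t = 0"
    by (rule vanishing_moments_imp_zero[where T = T and d = "\<lambda>t. c t * t"])
      (use assms(1,4) assms(3)[of "Suc _"] in \<open>simp_all add: mult.assoc\<close>)
  then show ?thesis using assms(2,4) by auto
qed

text \<open>
The monomials divisible by exactly two variables see only one side of the triangle. In degree 11 or more
they supply ten consecutive moments on each side, which determine weights at ten nonzero points.
\<close>

lemma no_relation_triangle_points_ge_11:
  assumes card: "card T1 = 10" "card T2 = 10" "card T3 = 10"
    and nz: "0 \<notin> T1" "0 \<notin> T2" "0 \<notin> T3" and n: "n \<ge> 11"
    and rel: "point_relation n (triangle_points T1 T2 T3) c" and l: "l \<in> triangle_points T1 T2 T3"
  shows "c l = 0"
proof -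
  have fin: "finite T1" "finite T2" "finite T3"
    using card by (auto intro: card_ge_0_finite)
  note rel' = rel[unfolded point_relation_triangle_points[OF fin nz(1,2)], rule_format]
  have "(\<Sum>t\<in>T1. c (lin 1 t 0) * t ^ j) = 0" if "1 \<le> j" "j \<le> 10" for j
    using rel'[of "n - j" j 0] that n by (simp add: power_0_left)
  then have 1: "c (lin 1 t 0) = 0" if "t \<in> T1" for t
    by (rule zero_of_moments_1_to_10[OF card(1) nz(1) _ that])
  have "(\<Sum>t\<in>T2. c (lin 1 0 t) * t ^ k) = 0" if "1 \<le> k" "k \<le> 10" for k
    using rel'[of "n - k" 0 k] that n by (simp add: power_0_left)
  then have 2: "c (lin 1 0 t) = 0" if "t \<in> T2" for t
    by (rule zero_of_moments_1_to_10[OF card(2) nz(2) _ that])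
  have "(\<Sum>t\<in>T3. c (lin 0 t 1) * t ^ j) = 0" if "1 \<le> j" "j \<le> 10" for j
    using rel'[of 0 j "n - j"] that n by (simp add: power_0_left)
  then have 3: "c (lin 0 t 1) = 0" if "t \<in> T3" for t
    by (rule zero_of_moments_1_to_10[OF card(3) nz(3) _ that])
  show ?thesis using l 1 2 3 unfolding triangle_points_def by blast
qed

lemma card_parameter_sets:
  "card {t::complex. t ^ 10 = 1} = 10" "card {t::complex. t ^ 10 = -1} = 10"
  "card {t::complex. t ^ 10 = 2} = 10" "card ({t::complex. t ^ 3 = -1} \<union> {t. t ^ 7 = 1}) = 10"
proof -
  show "card {t::complex. t ^ 10 = 1} = 10" "card {t::complex. t ^ 10 = -1} = 10"
    "card {t::complex. t ^ 10 = 2} = 10"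
    by (rule card_nth_roots; simp)+
  have fin: "finite {t::complex. t ^ 3 = -1}" "finite {t::complex. t ^ 7 = 1}"
    by (rule finite_nth_roots; simp)+
  have "card {t::complex. t ^ 3 = -1} = 3" "card {t::complex. t ^ 7 = 1} = 7"
    by (rule card_nth_roots; simp)+
  then show "card ({t::complex. t ^ 3 = -1} \<union> {t. t ^ 7 = 1}) = 10"
    by (simp only: card_Un_disjoint[OF fin cube_septic_roots_disjoint])
qed

lemma zero_notin_parameter_sets:
  "(0::complex) \<notin> {t. t ^ 10 = 1}" "(0::complex) \<notin> {t. t ^ 10 = -1}"
  "(0::complex) \<notin> {t. t ^ 10 = 2}" "(0::complex) \<notin> {t. t ^ 3 = -1} \<union> {t. t ^ 7 = 1}"
  by simp_all

lemma finite_parameter_sets: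
  "finite {t::complex. t ^ 10 = 1}" "finite {t::complex. t ^ 10 = -1}"
  "finite {t::complex. t ^ 10 = 2}" "finite ({t::complex. t ^ 3 = -1} \<union> {t. t ^ 7 = 1})"
  using card_parameter_sets by (auto intro: card_ge_0_finite)

text \<open>
The uniform weights on a side see only the vertices in degree 10, and with these signs the contributions
at each vertex cancel.
\<close>

lemma section_points_relation:
  "point_relation 10 section_points (\<lambda>l. if coords l 2 = 0 then 1 else -1)"
  unfolding section_points_def
    point_relation_triangle_points[OF finite_parameter_sets(1,2,1) zero_notin_parameter_sets(1,2)]
proof (intro allI impI)
  fix i j k :: nat assume ijk: "i + j + k = 10"
  let ?c = "\<lambda>l. if coords l 2 = 0 then 1 else -1 :: complex"
  have N: "(\<Sum>t | t ^ 10 = 1. ?c (lin 1 t 0) * t ^ j) = (\<Sum>t | t ^ 10 = 1. t ^ j)"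
    "(\<Sum>t | t ^ 10 = -1. ?c (lin 1 0 t) * t ^ k) = - (\<Sum>t | t ^ 10 = -1. t ^ k)"
    "(\<Sum>t | t ^ 10 = 1. ?c (lin 0 t 1) * t ^ j) = - (\<Sum>t | t ^ 10 = 1. t ^ j)"
  proof -
    show "(\<Sum>t | t ^ 10 = -1. ?c (lin 1 0 t) * t ^ k) = - (\<Sum>t | t ^ 10 = -1. t ^ k)"
      unfolding sum_negf[symmetric] using zero_notin_parameter_sets(2) by (intro sum.cong) auto
  qed (simp_all add: sum_negf)
  have dv: "10 dvd m \<longleftrightarrow> m = 0 \<or> m = 10" if "m \<le> 10" for m :: nat
    using that by (auto elim!: dvdE)
  have S1: "(\<Sum>t | t ^ 10 = (1::complex). t ^ m) = (if m = 0 \<or> m = 10 then 10 else 0)" if "m \<le> 10" for m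
    using dv[OF that] by (subst sum_powers_nth_roots) auto
  have S2: "(\<Sum>t | t ^ 10 = (-1::complex). t ^ m) = (if m = 0 then 10 else if m = 10 then -10 else 0)"
    if "m \<le> 10" for m
    using dv[OF that] by (subst sum_powers_nth_roots) auto
  have le: "j \<le> 10" "k \<le> 10" using ijk by simp_all
  show "(\<Sum>t | t ^ 10 = 1. ?c (lin 1 t 0) * t ^ j) * 0 ^ k +
      (\<Sum>t | t ^ 10 = -1. ?c (lin 1 0 t) * t ^ k) * 0 ^ j +
      (\<Sum>t | t ^ 10 = 1. ?c (lin 0 t 1) * t ^ j) * 0 ^ i = 0"
    unfolding N S1[OF le(1)] S2[OF le(2)] using ijk
    by (cases "i = 0"; cases "j = 0"; cases "k = 0") (simp_all add: power_0_left)
qed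

text \<open>
In degree 10 the interior monomials supply only nine moments on each side, so a relation is determined by
one number per side. Each of the three vertices gives one linear equation between two of these numbers.
Around the triangle the ratios of the two vertex moments on the sides multiply to \<open>-2\<close>, whereas a
nontrivial solution would require \<open>-1\<close>.
\<close>

lemma nonsection_points_no_relation:
  assumes rel: "point_relation 10 nonsection_points c" and l: "l \<in> nonsection_points"
  shows "c l = 0"
proof -
  let ?T1 = "{t::complex. t ^ 10 = 2}" and ?T2 = "{t::complex. t ^ 10 = -1}"
    and ?T3 = "{t::complex. t ^ 3 = -1} \<union> {t. t ^ 7 = 1}"
  note rel' = rel[unfolded nonsection_points_def
      point_relation_triangle_points[OF finite_parameter_sets(3,2,4) zero_notin_parameter_sets(3,2)], rule_format]
  define N1 where "N1 j = (\<Sum>t\<in>?T1. c (lin 1 t 0) * t ^ j)" for j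
  define N2 where "N2 j = (\<Sum>t\<in>?T2. c (lin 1 0 t) * t ^ j)" for j
  define N3 where "N3 j = (\<Sum>t\<in>?T3. c (lin 0 t 1) * t ^ j)" for j
  have R: "N1 j * 0 ^ k + N2 k * 0 ^ j + N3 j * 0 ^ i = 0" if "i + j + k = 10" for i j k
    unfolding N1_def N2_def N3_def by (rule rel'[OF that])
  have mid: "N1 j = 0" "N2 j = 0" "N3 j = 0" if "1 \<le> j" "j \<le> 9" for j
    using R[of "10 - j" j 0] R[of "10 - j" 0 j] R[of 0 j "10 - j"] that
    by (simp_all add: power_0_left)
  have vert: "N1 0 + N2 0 = 0" "N1 10 + N3 10 = 0" "N2 10 + N3 0 = 0"
    using R[of 10 0 0] R[of 0 10 0] R[of 0 0 10] by simp_all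
  have N1: "N1 10 = 2 * N1 0"
    unfolding N1_def sum_distrib_left by (rule sum.cong) auto
  have N2: "N2 10 = - N2 0"
    unfolding N2_def sum_negf[symmetric] by (rule sum.cong) auto
  \<comment> \<open>The coordinates on this side satisfy \<open>t\<^sup>1\<^sup>0 + t\<^sup>7 - t\<^sup>3 - 1 = 0\<close>.\<close>
  have N3: "N3 10 = N3 3 - N3 7 + N3 0"
    unfolding N3_def sum_subtractf[symmetric] sum.distrib[symmetric]
  proof (rule sum.cong)
    fix t assume "t \<in> ?T3"
    then have "(t ^ 3 + 1) * (t ^ 7 - 1) = 0" by auto
    moreover have "(t ^ 3 + 1) * (t ^ 7 - 1) = t ^ 10 - t ^ 3 + t ^ 7 - 1"
      by (simp add: algebra_simps flip: power_add)
    ultimately have t10: "t ^ 10 = t ^ 3 - t ^ 7 + 1" by (simp add: algebra_simps)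
    then show "c (lin 0 t 1) * t ^ 10 = c (lin 0 t 1) * t ^ 3 - c (lin 0 t 1) * t ^ 7 + c (lin 0 t 1) * t ^ 0"
      by (simp only: t10 power_0 mult_1_right distrib_left right_diff_distrib)
  qed simp
  have N30: "N3 10 = N3 0" using N3 mid(3)[of 3] mid(3)[of 7] by simp
  have "N2 0 = - N1 0" using vert(1) by (simp add: add_eq_0_iff)
  then have "N3 0 = - N1 0" "2 * N1 0 + N3 0 = 0" using vert N1 N2 N30 by (simp_all add: add_eq_0_iff)
  then have "N1 0 = 0" by simp
  then have zero: "N1 0 = 0" "N2 0 = 0" "N3 0 = 0"
    using \<open>N2 0 = - N1 0\<close> \<open>N3 0 = - N1 0\<close> by simp_all
  have all: "N1 j = 0" "N2 j = 0" "N3 j = 0" if "j < 10" for j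
    using mid[of j] zero that by (cases "j = 0"; simp)+
  have "c (lin 1 t 0) = 0" if "t \<in> ?T1" for t
    by (rule vanishing_moments_imp_zero[OF finite_parameter_sets(3) _ that, of "\<lambda>t. c (lin 1 t 0)"])
      (use all(1) in \<open>simp only: card_parameter_sets N1_def\<close>)
  moreover have "c (lin 1 0 t) = 0" if "t \<in> ?T2" for t
    by (rule vanishing_moments_imp_zero[OF finite_parameter_sets(2) _ that, of "\<lambda>t. c (lin 1 0 t)"])
      (use all(2) in \<open>simp only: card_parameter_sets N2_def\<close>)
  moreover have "c (lin 0 t 1) = 0" if "t \<in> ?T3" for t
    by (rule vanishing_moments_imp_zero[OF finite_parameter_sets(4) _ that, of "\<lambda>t. c (lin 0 t 1)"])
      (use all(3) in \<open>simp only: card_parameter_sets N3_def\<close>)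
  ultimately show ?thesis using l unfolding nonsection_points_def triangle_points_def by blast
qed

lemma eval3_lin: "eval3 (lin a b c) v = a * v 0 + b * v 1 + c * v 2"
  by (simp add: lin_def eval3_add eval3_mterm_mon del: One_nat_def)

text \<open>
The coordinates have absolute value 1, and the coefficients 1, 2 and 4 have distinct absolute values.
\<close>

lemma section_points_avoid_line:
  assumes "l \<in> section_points"
  shows "eval3 (lin 1 2 4) (coords l) \<noteq> 0"
proof
  assume 0: "eval3 (lin 1 2 4) (coords l) = 0"
  from assms consider t where "l = lin 1 t 0" "t ^ 10 = 1" | t where "l = lin 1 0 t" "t ^ 10 = -1"
    | t where "l = lin 0 t 1" "t ^ 10 = 1"
    unfolding section_points_def triangle_points_def by blast
  then show False
  proof cases
    case 1
    then have "2 * t = - 1" using 0 by (simp add: eval3_lin add_eq_0_iff)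
    then have "(2 * t) ^ 10 = 1" by simp
    then show False using 1(2) by (simp add: power_mult_distrib)
  next
    case 2
    then have "4 * t = - 1" using 0 by (simp add: eval3_lin add_eq_0_iff)
    then have "(4 * t) ^ 10 = 1" by simp
    then show False using 2(2) by (simp add: power_mult_distrib)
  next
    case 3
    then have "2 * t = - 4" using 0 by (simp add: eval3_lin add_eq_0_iff2)
    then have "(2 * t) ^ 10 = 4 ^ 10" by simp
    then show False using 3(2) by (simp add: power_mult_distrib)
  qed
qed

lemma regularity_section_points: "regularity (proj_point ` section_points) > 10"
  and regularity_nonsection_points: "regularity (proj_point ` nonsection_points) \<le> 10"
proof -
  have fin: "finite section_points" "finite nonsection_points"
    unfolding section_points_def nonsection_points_def
    by (intro finite_triangle_points finite_parameter_sets)+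
  have nz: "0 \<notin> section_points" "0 \<notin> nonsection_points"
    unfolding section_points_def nonsection_points_def using triangle_points_linear by blast+
  let ?s = "hilbert_function (proj_point ` section_points)"
  let ?g = "hilbert_function (proj_point ` nonsection_points)"
  have s11: "?s (int n) = int (card section_points)" if "n \<ge> 11" for n
    by (rule hilbert_function_eq_card[OF fin(1) nz(1)],
        unfold section_points_def,
        rule no_relation_triangle_points_ge_11[OF card_parameter_sets(1,2,1) zero_notin_parameter_sets(1,2,1) that])
  have mem: "lin 1 1 0 \<in> section_points"
    by (auto simp: section_points_def triangle_points_def)
  have s10: "?s (int 10) < int (card section_points)"
    by (rule hilbert_function_less_card[OF fin(1) nz(1) section_points_relation mem]) simp
  \<comment> \<open>A value repeated that early would be repeated forever, but the values in degrees 10 and 11 differ.\<close>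
  have no_early: "?s (int i) \<noteq> ?s (int i + 1)" if "i \<le> 10" for i
  proof
    assume eq: "?s (int i) = ?s (int i + 1)"
    note stable = hilbert_function_stable[OF fin(1) nz(1) lin_in_graded_piece section_points_avoid_line eq]
    have "?s (int 10) = ?s (int i)" by (rule stable[OF _ that])
    moreover have "?s (int 11) = ?s (int i)" by (rule stable) (use that in simp_all)
    ultimately show False using s10 s11[of 11] by simp
  qed
  have "?s (int 11) = ?s (int 11 + 1)"
    using s11[of 11] s11[of 12] by simp
  then have "?s (int (regularity (proj_point ` section_points))) =
      ?s (int (regularity (proj_point ` section_points)) + 1)"
    unfolding regularity_def by (rule LeastI)
  then show "regularity (proj_point ` section_points) > 10"
    using no_early by (meson linorder_not_less)
  have "?g (int 10) = int (card nonsection_points)"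
    by (rule hilbert_function_eq_card[OF fin(2) nz(2)]) (rule nonsection_points_no_relation)
  moreover have "?g (int 11) = int (card nonsection_points)"
    by (rule hilbert_function_eq_card[OF fin(2) nz(2)],
        unfold nonsection_points_def,
        rule no_relation_triangle_points_ge_11[OF card_parameter_sets(3,2,4) zero_notin_parameter_sets(3,2,4) order_refl])
  ultimately have "?g (int 10) = ?g (int 10 + 1)" by simp
  then show "regularity (proj_point ` nonsection_points) \<le> 10"
    unfolding regularity_def by (rule Least_le)
qed

theorem theorem3p8:
  "\<exists>f \<in> graded_piece 13. waring_rank 13 f = 30 \<and>
    (\<exists>Z1 Z2. computes_rank 13 Z1 f \<and> computes_rank 13 Z2 f \<and>
      hilbert_function Z1 \<noteq> hilbert_function Z2 \<and>
      regularity Z1 \<noteq> regularity Z2)"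
proof (intro bexI conjI exI)
  show "waring_rank 13 ternary_form = 30"
    by (rule computes_rank_triangle_points(1)[OF finite_parameter_sets(1,2,1) zero_notin_parameter_sets(1,2,1)
          card_parameter_sets(1,2,1) ternary_form_in_span_section[unfolded section_points_def]])
  show "computes_rank 13 (proj_point ` section_points) ternary_form"
    unfolding section_points_def
    by (rule computes_rank_triangle_points(2)[OF finite_parameter_sets(1,2,1) zero_notin_parameter_sets(1,2,1)
          card_parameter_sets(1,2,1) ternary_form_in_span_section[unfolded section_points_def]])
  show "computes_rank 13 (proj_point ` nonsection_points) ternary_form"
    unfolding nonsection_points_def
    by (rule computes_rank_triangle_points(2)[OF finite_parameter_sets(3,2,4) zero_notin_parameter_sets(3,2,4)
          card_parameter_sets(3,2,4) ternary_form_in_span_nonsection[unfolded nonsection_points_def]])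
  show reg: "regularity (proj_point ` section_points) \<noteq> regularity (proj_point ` nonsection_points)"
    using regularity_section_points regularity_nonsection_points by linarith
  then show "hilbert_function (proj_point ` section_points) \<noteq> hilbert_function (proj_point ` nonsection_points)"
    unfolding regularity_def by metis
qed (rule ternary_form_in_graded_piece)

end
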